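(* Let $S(t)$, $t\ge 0$, be a strongly continuous semigroup with generator $A$ on a complex Hilbert space $\mathcal H$. Let $\omega\in\mathbb R$ and assume that the half-plane $\{\Re z\ge\omega\}$ is contained in the resolvent set of $A$ and that $\|(z-A)^{-1}\|$ is uniformly bounded there; let $r(\omega)\in\,]0,+\infty[$ be defined by $\frac1{r(\omega)}=\sup_{\Re z>\omega}\|(z-A)^{-1}\|$. Let $m:[0,+\infty[\to\,]0,+\infty[$ be continuous with $\|S(t)\|\le m(t)$ for all $t\ge0$. Then for all $a,b>0$ and all $t>a+b$, $$\|S(t)\|\le\frac{e^{\omega t-r(\omega)(t-a-b)}}{r(\omega)}\ \frac{1}{\left\|\frac1m\right\|_{e^{-\omega\cdot}L^2(0,a)}\left\|\frac1m\right\|_{e^{-\omega\cdot}L^2(0,b)}}.$$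
   Context: The weighted norm is $\|f\|_{e^{-\omega\cdot}L^2(0,a)}=\|e^{\omega\cdot}f\|_{L^2(0,a)}=\left(\int_0^a e^{2\omega s}|f(s)|^2ds\right)^{1/2}$. *)

theory Defs
  imports "HOL-Analysis.Analysis"
begin

text \<open>Complex inner product spaces, linear in the first argument. The real inner product
  inherited from \<^class>\<open>real_inner\<close> is pinned down as the real part of the complex one, so that
  positive definiteness and the identity of the norm with the square root of \<open>\<langle>x, x\<rangle>\<close> come from
  the axioms of \<^class>\<open>real_inner\<close>.\<close>

class complex_inner = real_inner +
  fixes scaleC :: "complex \<Rightarrow> 'a \<Rightarrow> 'a" (infixr "*\<^sub>C" 75)
    and cinner :: "'a \<Rightarrow> 'a \<Rightarrow> complex"
  assumes scaleC_add_right: "c *\<^sub>C (x + y) = c *\<^sub>C x + c *\<^sub>C y"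
    and scaleC_add_left: "(c + d) *\<^sub>C x = c *\<^sub>C x + d *\<^sub>C x"
    and scaleC_scaleC: "c *\<^sub>C (d *\<^sub>C x) = (c * d) *\<^sub>C x"
    and scaleC_one: "1 *\<^sub>C x = x"
    and scaleR_scaleC: "scaleR r x = complex_of_real r *\<^sub>C x"
    and cinner_commute: "cinner x y = cnj (cinner y x)"
    and cinner_add_left: "cinner (x + y) z = cinner x z + cinner y z"
    and cinner_scaleC_left: "cinner (c *\<^sub>C x) y = c * cinner x y"
    and inner_eq_Re_cinner: "inner x y = Re (cinner x y)"

class complex_hilbert = complex_inner + complete_space

instantiation complex :: complex_hilbert
begin

definition scaleC_complex :: "complex \<Rightarrow> complex \<Rightarrow> complex"
  where "scaleC_complex c x = c * x"

definition cinner_complex :: "complex \<Rightarrow> complex \<Rightarrow> complex"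
  where "cinner_complex x y = x * cnj y"

instance
  by standard
    (auto simp: scaleC_complex_def cinner_complex_def inner_complex_def scaleR_conv_of_real
      algebra_simps)

end

definition bounded_clinear :: "('h::complex_inner \<Rightarrow> 'h) \<Rightarrow> bool"
  where "bounded_clinear T \<longleftrightarrow> bounded_linear T \<and> (\<forall>c x. T (c *\<^sub>C x) = c *\<^sub>C T x)"

text \<open>A semigroup is indexed by all reals for convenience; its values at negative times are
  irrelevant.\<close>

definition C0_semigroup :: "(real \<Rightarrow> 'h::complex_hilbert \<Rightarrow> 'h) \<Rightarrow> bool"
  where "C0_semigroup S \<longleftrightarrow>
    (\<forall>t\<ge>0. bounded_clinear (S t)) \<and>
    S 0 = id \<and>
    (\<forall>s\<ge>0. \<forall>t\<ge>0. S (s + t) = S s \<circ> S t) \<and>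
    (\<forall>x. continuous_on {0..} (\<lambda>t. S t x))"

text \<open>An unbounded operator is given by its domain \<open>D\<close> and a function \<open>A\<close> of which only the
  values on \<open>D\<close> matter.\<close>

definition is_generator ::
    "(real \<Rightarrow> 'h::complex_hilbert \<Rightarrow> 'h) \<Rightarrow> 'h set \<Rightarrow> ('h \<Rightarrow> 'h) \<Rightarrow> bool"
  where "is_generator S D A \<longleftrightarrow>
    D = {x. \<exists>y. ((\<lambda>h. (1 / h) *\<^sub>R (S h x - x)) \<longlongrightarrow> y) (at_right 0)} \<and>
    (\<forall>x\<in>D. ((\<lambda>h. (1 / h) *\<^sub>R (S h x - x)) \<longlongrightarrow> A x) (at_right 0))"

definition resolvent :: "'h::complex_hilbert set \<Rightarrow> ('h \<Rightarrow> 'h) \<Rightarrow> complex \<Rightarrow> 'h \<Rightarrow> 'h"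
  where "resolvent D A z = inv_into D (\<lambda>x. z *\<^sub>C x - A x)"

definition resolvent_set :: "'h::complex_hilbert set \<Rightarrow> ('h \<Rightarrow> 'h) \<Rightarrow> complex set"
  where "resolvent_set D A =
    {z. bij_betw (\<lambda>x. z *\<^sub>C x - A x) D UNIV \<and> bounded_clinear (resolvent D A z)}"

text \<open>The norm of \<open>f\<close> in \<open>e\<^sup>-\<^sup>\<omega>\<^sup>\<cdot>L\<^sup>2(0,a)\<close>, i.e. the \<open>L\<^sup>2(0,a)\<close> norm of \<open>e\<^sup>\<omega>\<^sup>\<cdot>f\<close>.\<close>

definition weighted_L2_norm :: "real \<Rightarrow> real \<Rightarrow> (real \<Rightarrow> real) \<Rightarrow> real"
  where "weighted_L2_norm \<omega> a f =
    sqrt (LINT s:{0<..<a}|lborel. exp (2 * \<omega> * s) * \<bar>f s\<bar>\<^sup>2)"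

end

theory Submission
  imports Defs "HOL-Real_Asymp.Real_Asymp"
begin

text \<open>Why the bound holds. Let \<open>p s = exp (- \<omega> * s) *\<^sub>R S s y\<close> be a rescaled orbit and let \<open>\<Phi>\<close> be a
continuous, piecewise smooth real function vanishing at both ends of \<open>[0, T]\<close>. Since \<open>p\<close> solves
\<open>p' = (A - \<omega>) p\<close>, the product \<open>\<Phi> p\<close> solves the inhomogeneous equation with right hand side
\<open>\<Phi>' p\<close>, so the Fourier coefficients of \<open>\<Phi> p\<close> on \<open>[0, T]\<close> are those of \<open>\<Phi>' p\<close> with the
resolvent of \<open>A\<close> applied to them, at points of the line \<open>Re z = \<omega>\<close>. The resolvent is bounded by
\<open>1 / r\<close> there, and Parseval for \<open>\<Phi> p\<close> with Bessel for \<open>\<Phi>' p\<close> gives the energy inequality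
\<open>0 \<le> \<integral> (\<Phi>'\<^sup>2 - r\<^sup>2 \<Phi>\<^sup>2) \<bar>p\<bar>\<^sup>2\<close> (\<open>energy_inequality\<close>, \<open>orbit_energy_inequality\<close>).

The theorem is this inequality for a good \<open>\<Phi>\<close> (\<open>weighted_decay_from_energy\<close>). With
\<open>g s = exp (\<omega> * s) / m s\<close>, so that \<open>\<bar>p s\<bar> g s \<le> \<bar>y\<bar>\<close>, let \<open>\<Phi>\<close> be proportional to \<open>\<integral>\<^sub>0\<^sup>s g\<^sup>2\<close>
on \<open>[0, a]\<close>, which is the cheapest way to rise from 0 to 1 and costs at most \<open>\<bar>y\<bar>\<^sup>2\<close> divided by
the squared weighted norm of \<open>1 / m\<close> on \<open>[0, a]\<close>. On \<open>[a, t - b]\<close> let \<open>\<Phi>\<close> grow like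
\<open>exp (r * s)\<close>, where the integrand vanishes: this free growth is the source of the factor
\<open>exp (- r * (t - a - b))\<close>. On \<open>[t - b, t]\<close> let \<open>\<Phi>\<close> be constant; there the integrand is
negative, and as \<open>\<bar>p t\<bar> g (t - s) \<le> \<bar>p s\<bar>\<close> it produces the squared norm on \<open>[0, b]\<close> times \<open>\<bar>p t\<bar>\<^sup>2\<close>. On
\<open>[t, T]\<close> let \<open>\<Phi>\<close> descend to 0 as a hyperbolic sine.

The cost of the descent tends to 0 for \<open>T \<rightarrow> \<infinity>\<close> if \<open>\<bar>p\<bar>\<close> grows more slowly than
\<open>exp (r * s)\<close>. This is not known in advance, so it is bootstrapped
(\<open>exponentially_bounded_bootstrap\<close>): the hypotheses hold on every line \<open>Re z = \<mu>\<close> with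
\<open>\<mu> \<ge> \<omega>\<close>, and the bound obtained there from growth of exponential type \<open>\<mu> + r / 2\<close> yields type
\<open>\<mu>\<close>. Every semigroup has some finite type, so finitely many such steps reach \<open>\<omega>\<close>.

The Hilbert space may be nonseparable, so vector-valued integrals are Henstock-Kurzweil
integrals of functions for which integrability is elementary; this is also why Fourier series on a
bounded interval are used rather than the Fourier transform on the line.\<close>

section \<open>Complex scalar multiplication\<close>

instance complex_hilbert \<subseteq> banach ..

lemma scaleC_zero_left [simp]: "0 *\<^sub>C (x::'a::complex_inner) = 0"
  by (metis scaleC_add_left add_cancel_right_right)

lemma scaleC_zero_right [simp]: "c *\<^sub>C (0::'a::complex_inner) = 0"
  by (metis scaleC_add_right add_cancel_right_right)

lemma scaleC_minus_right: "c *\<^sub>C (- x::'a::complex_inner) = - (c *\<^sub>C x)"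
  by (metis scaleC_add_right scaleC_zero_right add.right_inverse add_eq_0_iff)

lemma scaleC_minus_left: "(- c) *\<^sub>C (x::'a::complex_inner) = - (c *\<^sub>C x)"
  by (metis scaleC_add_left scaleC_zero_left add.right_inverse add_eq_0_iff)

lemma scaleC_diff_right: "c *\<^sub>C (x - y::'a::complex_inner) = c *\<^sub>C x - c *\<^sub>C y"
  by (metis scaleC_add_right scaleC_minus_right diff_conv_add_uminus)

lemma scaleC_diff_left: "(c - d) *\<^sub>C (x::'a::complex_inner) = c *\<^sub>C x - d *\<^sub>C x"
  by (metis scaleC_add_left scaleC_minus_left diff_conv_add_uminus)

lemma inner_scaleC_left: "inner (c *\<^sub>C x) (y::'a::complex_inner) = inner x (cnj c *\<^sub>C y)"
proof -
  have "cinner x (cnj c *\<^sub>C y) = cnj (cnj c * cinner y x)"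
    by (metis cinner_commute cinner_scaleC_left)
  also have "\<dots> = c * cinner x y"
    by (metis cinner_commute complex_cnj_cnj complex_cnj_mult)
  finally show ?thesis
    by (simp add: inner_eq_Re_cinner cinner_scaleC_left)
qed

lemma norm_scaleC: "norm (c *\<^sub>C (x::'a::complex_inner)) = cmod c * norm x"
proof -
  have "cnj c *\<^sub>C c *\<^sub>C x = (cmod c)\<^sup>2 *\<^sub>R x"
    unfolding scaleC_scaleC scaleR_scaleC complex_norm_square by (simp only: mult.commute)
  then have "(norm (c *\<^sub>C x))\<^sup>2 = (cmod c * norm x)\<^sup>2"
    by (simp add: power2_norm_eq_inner inner_scaleC_left power_mult_distrib)
  then show ?thesis
    by (metis abs_mult abs_norm_cancel power2_eq_iff_nonneg norm_ge_zero mult_nonneg_nonneg)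
qed

lemma scaleC_scaleR: "c *\<^sub>C (a *\<^sub>R x) = a *\<^sub>R (c *\<^sub>C (x::'a::complex_inner))"
  by (simp add: scaleR_scaleC scaleC_scaleC mult.commute)

lemma bounded_bilinear_scaleC: "bounded_bilinear ((*\<^sub>C) :: complex \<Rightarrow> 'a::complex_inner \<Rightarrow> 'a)"
proof
  show "(a *\<^sub>R c) *\<^sub>C x = a *\<^sub>R (c *\<^sub>C x)" for a c and x :: 'a
    unfolding scaleR_conv_of_real by (simp add: scaleR_scaleC scaleC_scaleC)
  show "\<exists>K. \<forall>c (x::'a). norm (c *\<^sub>C x) \<le> norm c * norm x * K"
    by (rule exI[of _ 1]) (simp add: norm_scaleC)
qed (simp_all add: scaleC_add_left scaleC_add_right scaleC_scaleR)

lemmas bounded_linear_scaleC_right = bounded_bilinear.bounded_linear_right[OF bounded_bilinear_scaleC]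
lemmas bounded_linear_scaleC_left = bounded_bilinear.bounded_linear_left[OF bounded_bilinear_scaleC]
lemmas continuous_on_scaleC [continuous_intros] =
  bounded_bilinear.continuous_on[OF bounded_bilinear_scaleC]
lemmas tendsto_scaleC [tendsto_intros] = bounded_bilinear.tendsto[OF bounded_bilinear_scaleC]

section \<open>Fourier series of Hilbert space valued functions\<close>

definition freq :: "real \<Rightarrow> int \<Rightarrow> real"
  where "freq T n = 2 * pi * of_int n / T"

definition fourier :: "real \<Rightarrow> (real \<Rightarrow> 'h::complex_hilbert) \<Rightarrow> int \<Rightarrow> 'h"
  where "fourier T f n = integral {0..T} (\<lambda>s. cis (- (freq T n * s)) *\<^sub>C f s)"

lemma freq_diff: "freq T (m - n) = freq T m - freq T n"
  by (simp add: freq_def algebra_simps diff_divide_distrib)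

lemma has_integral_cis_freq:
  assumes "T > 0"
  shows "((\<lambda>s. cis (freq T k * s)) has_integral (if k = 0 then of_real T else 0)) {0..T}"
proof (cases "k = 0")
  case True
  then show ?thesis
    using has_integral_const_real[of "1::complex" 0 T] assms by (simp add: freq_def scaleR_conv_of_real)
next
  case False
  define \<xi> where "\<xi> = freq T k"
  have \<xi>: "\<xi> \<noteq> 0" using False assms by (simp add: \<xi>_def freq_def)
  have "((\<lambda>s. exp (\<i> * of_real \<xi> * of_real s)) has_integral
      exp (\<i> * of_real \<xi> * of_real T) / (\<i> * of_real \<xi>) - exp (\<i> * of_real \<xi> * of_real 0) / (\<i> * of_real \<xi>)) {0..T}"
  proof (rule fundamental_theorem_of_calculus)
    fix x
    have "((\<lambda>z. exp (\<i> * of_real \<xi> * z) / (\<i> * of_real \<xi>)) has_field_derivative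
        exp (\<i> * of_real \<xi> * of_real x)) (at (of_real x))"
      using \<xi> by (auto intro!: derivative_eq_intros)
    then show "((\<lambda>s. exp (\<i> * of_real \<xi> * of_real s) / (\<i> * of_real \<xi>)) has_vector_derivative
        exp (\<i> * of_real \<xi> * of_real x)) (at x within {0..T})"
      by (rule has_vector_derivative_real_field)
  qed (use assms in simp)
  moreover have "exp (\<i> * of_real \<xi> * of_real T) = 1"
  proof -
    have "\<i> * of_real \<xi> * of_real T = 2 * of_real (of_int k) * of_real pi * \<i>"
      using assms by (simp add: \<xi>_def freq_def field_simps)
    then show ?thesis
      using exp_integer_2pi[of "of_int k"] by (simp only:) simp
  qed
  ultimately show ?thesis
    using False by (simp add: cis_conv_exp \<xi>_def mult.assoc)
qed

lemma has_integral_cis_freq_scaleC: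
  fixes b :: "'h::complex_hilbert"
  assumes "T > 0"
  shows "((\<lambda>s. cis (freq T k * s) *\<^sub>C b) has_integral (if k = 0 then of_real T else 0) *\<^sub>C b) {0..T}"
  using has_integral_linear[OF has_integral_cis_freq[OF assms, of k] bounded_linear_scaleC_left[of b]]
  by (simp only: o_def)

lemma continuous_on_cis [continuous_intros]:
  "continuous_on A f \<Longrightarrow> continuous_on A (\<lambda>s. cis (f s))"
  by (simp add: cis_conv_exp continuous_intros)

lemma integrable_cis_scaleC:
  fixes f :: "real \<Rightarrow> 'h::complex_hilbert"
  assumes "continuous_on {0..T} f"
  shows "(\<lambda>s. cis (- (freq T n * s)) *\<^sub>C f s) integrable_on {0..T}"
  using assms by (intro integrable_continuous_real continuous_on_scaleC continuous_intros)


lemma has_vector_derivative_iff_quotient: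
  "(f has_vector_derivative d) (at x within S) \<longleftrightarrow>
    ((\<lambda>y. (1 / (y - x)) *\<^sub>R (f y - f x)) \<longlongrightarrow> d) (at x within S)"
proof -
  have eq: "norm ((1 / (y - x)) *\<^sub>R (f y - f x) - d) = norm (f y - f x - (y - x) *\<^sub>R d) / norm (y - x)"
    if "y \<noteq> x" for y
  proof -
    have "(1 / (y - x)) *\<^sub>R (f y - f x) - d = (1 / (y - x)) *\<^sub>R (f y - f x - (y - x) *\<^sub>R d)"
      using that by (simp add: scaleR_diff_right)
    then show ?thesis by (simp add: divide_inverse mult.commute)
  qed
  have "(f has_vector_derivative d) (at x within S) \<longleftrightarrow>
      ((\<lambda>y. norm (f y - f x - (y - x) *\<^sub>R d) / norm (y - x)) \<longlongrightarrow> 0) (at x within S)"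
    by (simp add: has_vector_derivative_def has_derivative_iff_norm bounded_linear_scaleR_left)
  also have "\<dots> \<longleftrightarrow> ((\<lambda>y. norm ((1 / (y - x)) *\<^sub>R (f y - f x) - d)) \<longlongrightarrow> 0) (at x within S)"
    by (intro filterlim_cong refl) (auto simp: eventually_at_filter eq)
  also have "\<dots> \<longleftrightarrow> ((\<lambda>y. (1 / (y - x)) *\<^sub>R (f y - f x)) \<longlongrightarrow> d) (at x within S)"
    by (subst tendsto_norm_zero_iff) (rule LIM_zero_iff)
  finally show ?thesis .
qed

lemma has_integral_inner_left:
  assumes "(f has_integral y) S"
  shows "((\<lambda>s. inner (f s) (a::'a::real_inner)) has_integral inner y a) S"
  using has_integral_linear[OF assms bounded_linear_inner_left] by (simp add: o_def)

lemma inner_cis_scaleC_right: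
  "inner x (cis \<theta> *\<^sub>C (y::'h::complex_inner)) = inner (cis (- \<theta>) *\<^sub>C x) y"
  by (simp add: inner_scaleC_left cis_cnj)

text \<open>Orthogonality of the characters \<open>cis (freq T n * s)\<close>; Bessel's inequality and the norm of the Fourier partial sums both reduce to this.\<close>

lemma has_integral_norm_trig_poly:
  fixes a :: "int \<Rightarrow> 'h::complex_hilbert"
  assumes T: "T > 0" and I: "finite I"
  shows "((\<lambda>s. (norm (\<Sum>n\<in>I. cis (freq T n * s) *\<^sub>C a n))\<^sup>2) has_integral T * (\<Sum>n\<in>I. (norm (a n))\<^sup>2)) {0..T}"
proof -
  have eq: "(norm (\<Sum>n\<in>I. cis (freq T n * s) *\<^sub>C a n))\<^sup>2 =
      (\<Sum>n\<in>I. \<Sum>m\<in>I. inner (cis (freq T (m - n) * s) *\<^sub>C a m) (a n))" for s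
  proof -
    have "inner (cis (freq T m * s) *\<^sub>C a m) (cis (freq T n * s) *\<^sub>C a n)
        = inner (cis (freq T (m - n) * s) *\<^sub>C a m) (a n)" for m n
      unfolding inner_cis_scaleC_right scaleC_scaleC cis_mult freq_diff
      by (simp add: left_diff_distrib)
    then show ?thesis
      by (simp add: power2_norm_eq_inner inner_sum_right inner_sum_left)
  qed
  have "((\<lambda>s. \<Sum>n\<in>I. \<Sum>m\<in>I. inner (cis (freq T (m - n) * s) *\<^sub>C a m) (a n)) has_integral
      (\<Sum>n\<in>I. \<Sum>m\<in>I. inner ((if m - n = 0 then of_real T else 0) *\<^sub>C a m) (a n))) {0..T}"
    by (intro has_integral_sum has_integral_inner_left has_integral_cis_freq_scaleC T I)
  moreover have "(\<Sum>m\<in>I. inner ((if m - n = 0 then of_real T else 0) *\<^sub>C a m) (a n)) = T * (norm (a n))\<^sup>2"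
    if "n \<in> I" for n
  proof -
    have "(\<Sum>m\<in>I. inner ((if m - n = 0 then of_real T else 0) *\<^sub>C a m) (a n))
        = (\<Sum>m\<in>I. if m = n then T * inner (a n) (a n) else 0)"
      by (intro sum.cong) (auto simp: scaleR_scaleC[symmetric])
    then show ?thesis using that I by (simp add: power2_norm_eq_inner)
  qed
  ultimately show ?thesis by (simp add: eq sum_distrib_left)
qed

text \<open>The integral of \<open>\<bar>v - P\<bar>\<^sup>2 \<ge> 0\<close>, for the partial sum \<open>P\<close> with the Fourier coefficients of \<open>v\<close>,
expands to the difference of the two sides. Only integrability is assumed of \<open>v\<close>, because the
function \<open>\<Phi>' p\<close> to which it is applied jumps at the breakpoints of \<open>\<Phi>\<close>.\<close>

lemma bessel_inequality:
  fixes v :: "real \<Rightarrow> 'h::complex_hilbert"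
  assumes T: "T > 0" and I: "finite I"
    and coeff: "\<And>n. n \<in> I \<Longrightarrow> (\<lambda>s. cis (- (freq T n * s)) *\<^sub>C v s) integrable_on {0..T}"
    and sq: "(\<lambda>s. (norm (v s))\<^sup>2) integrable_on {0..T}"
  shows "(\<Sum>n\<in>I. (norm (fourier T v n))\<^sup>2) \<le> T * integral {0..T} (\<lambda>s. (norm (v s))\<^sup>2)"
proof -
  define a where "a n = (1/T) *\<^sub>R fourier T v n" for n
  define P where "P s = (\<Sum>n\<in>I. cis (freq T n * s) *\<^sub>C a n)" for s
  define B where "B = (\<Sum>n\<in>I. (norm (fourier T v n))\<^sup>2)"
  have vP: "((\<lambda>s. inner (v s) (P s)) has_integral B / T) {0..T}"
  proof -
    have "((\<lambda>s. \<Sum>n\<in>I. inner (cis (- (freq T n * s)) *\<^sub>C v s) (a n)) has_integral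
        (\<Sum>n\<in>I. inner (fourier T v n) (a n))) {0..T}"
      using coeff by (intro has_integral_sum I has_integral_inner_left)
        (auto simp: fourier_def intro: integrable_integral)
    then show ?thesis
      by (simp add: P_def inner_sum_right inner_cis_scaleC_right B_def a_def sum_divide_distrib
          power2_norm_eq_inner)
  qed
  have PP: "((\<lambda>s. (norm (P s))\<^sup>2) has_integral B / T) {0..T}"
  proof -
    have "T * (\<Sum>n\<in>I. (norm (a n))\<^sup>2) = B / T"
    proof -
      have "T * (norm (a n))\<^sup>2 = (norm (fourier T v n))\<^sup>2 / T" for n
        using T by (simp add: a_def power_divide) (simp add: power2_eq_square)
      then show ?thesis by (simp add: B_def sum_distrib_left sum_divide_distrib)
    qed
    then show ?thesis
      using has_integral_norm_trig_poly[OF T I, of a] by (simp only: P_def)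
  qed
  have "((\<lambda>s. (norm (v s))\<^sup>2 - 2 * inner (v s) (P s) + (norm (P s))\<^sup>2) has_integral
      integral {0..T} (\<lambda>s. (norm (v s))\<^sup>2) - 2 * (B / T) + B / T) {0..T}"
    by (intro has_integral_add has_integral_diff has_integral_mult_right vP PP integrable_integral sq)
  moreover have "(norm (v s))\<^sup>2 - 2 * inner (v s) (P s) + (norm (P s))\<^sup>2 = (norm (v s - P s))\<^sup>2" for s
    by (simp add: power2_norm_eq_inner inner_diff_left inner_diff_right inner_commute)
  ultimately have "((\<lambda>s. (norm (v s - P s))\<^sup>2) has_integral
      integral {0..T} (\<lambda>s. (norm (v s))\<^sup>2) - 2 * (B / T) + B / T) {0..T}"
    by simp
  then have "0 \<le> integral {0..T} (\<lambda>s. (norm (v s))\<^sup>2) - 2 * (B / T) + B / T"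
    by (rule has_integral_nonneg) simp
  then show ?thesis
    using T by (simp add: B_def[symmetric] field_simps)
qed

definition fourier_sum :: "real \<Rightarrow> (real \<Rightarrow> 'h::complex_hilbert) \<Rightarrow> nat \<Rightarrow> real \<Rightarrow> 'h"
  where "fourier_sum T f N s = (\<Sum>n = - int N..int N. cis (freq T n * s) *\<^sub>C ((1/T) *\<^sub>R fourier T f n))"

text \<open>The Riemann-Lebesgue lemma along any injective sequence of frequencies, from Bessel's inequality.\<close>

lemma fourier_tendsto_0:
  fixes f :: "real \<Rightarrow> 'h::complex_hilbert"
  assumes T: "T > 0" and f: "continuous_on {0..T} f"
    and e: "inj e"
  shows "(\<lambda>N. fourier T f (e N)) \<longlonglongrightarrow> 0"
proof -
  have "(\<Sum>k<N. (norm (fourier T f (e k)))\<^sup>2) \<le> T * integral {0..T} (\<lambda>s. (norm (f s))\<^sup>2)" for N :: nat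
  proof -
    have "(\<Sum>k<N. (norm (fourier T f (e k)))\<^sup>2) = (\<Sum>n\<in>e ` {..<N}. (norm (fourier T f n))\<^sup>2)"
      using e by (subst sum.reindex) (auto intro: inj_on_subset)
    also have "\<dots> \<le> T * integral {0..T} (\<lambda>s. (norm (f s))\<^sup>2)"
      by (intro bessel_inequality integrable_cis_scaleC T f integrable_continuous_real continuous_intros) auto
    finally show ?thesis .
  qed
  then have "summable (\<lambda>k. (norm (fourier T f (e k)))\<^sup>2)"
    by (intro bounded_imp_summable) (auto simp: lessThan_Suc_atMost[symmetric] simp del: sum.lessThan_Suc)
  then have "(\<lambda>k. (norm (fourier T f (e k)))\<^sup>2) \<longlonglongrightarrow> 0"
    by (rule summable_LIMSEQ_zero)
  from tendsto_real_sqrt[OF this] show ?thesis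
    by (simp add: tendsto_norm_zero_iff)
qed

lemma cis_sub_1_quotient_tendsto:
  "((\<lambda>t. (1 / (t - t0)) *\<^sub>R (cis (\<xi> * (t - t0)) - 1)) \<longlongrightarrow> \<i> * of_real \<xi>) (at t0)"
proof -
  have "((\<lambda>z. exp (\<i> * of_real \<xi> * (z - of_real t0))) has_field_derivative
      \<i> * of_real \<xi>) (at (of_real t0))"
    by (auto intro!: derivative_eq_intros)
  from has_vector_derivative_real_field[OF this]
  have "((\<lambda>t. cis (\<xi> * (t - t0))) has_vector_derivative \<i> * of_real \<xi>) (at t0)"
    by (simp add: cis_conv_exp algebra_simps)
  then show ?thesis
    by (simp add: has_vector_derivative_iff_quotient)
qed

lemma sum_int_telescope:
  fixes G :: "int \<Rightarrow> 'a::ab_group_add"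
  shows "(\<Sum>n = - int N..int N. G (n - 1) - G n) = G (- int N - 1) - G (int N)"
proof (induction N)
  case (Suc N)
  have cancel: "(A - B) + ((C - D) + (B - C)) = A - D" for A B C D :: 'a
    by (metis add.commute add_diff_cancel_right' diff_add_cancel add_diff_eq)
  have split: "{- int (Suc N)..int (Suc N)} = insert (- int N - 1) (insert (int N + 1) {- int N..int N})"
    by auto
  have "(\<Sum>n = - int (Suc N)..int (Suc N). G (n - 1) - G n) =
      (G (- int N - 1 - 1) - G (- int N - 1)) + ((G (int N + 1 - 1) - G (int N + 1))
        + (G (- int N - 1) - G (int N)))"
    unfolding split Suc[symmetric] by (subst sum.insert; simp)
  also have "\<dots> = G (- int N - 1 - 1) - G (int N + 1)"
    by (simp only: add_diff_cancel_right' cancel)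
  finally show ?case by (simp only: of_nat_Suc minus_add_distrib) (simp add: add.commute)
qed simp
text \<open>Chernoff's argument for pointwise convergence. Divide \<open>w t - w t0\<close> by
\<open>cis (freq T 1 * (t - t0)) - 1\<close>. Because \<open>w\<close> is differentiable at the interior point \<open>t0\<close>, the
quotient \<open>g\<close> is continuous on \<open>[0, T]\<close>; the denominator shifts the frequency by one, so each term of
the series of \<open>w - w t0\<close> is a difference of consecutive terms of the series of \<open>g\<close>. The sum
telescopes to two terms that vanish by the Riemann-Lebesgue lemma.\<close>

lemma fourier_sum_tendsto:
  fixes w :: "real \<Rightarrow> 'h::complex_hilbert"
  assumes w: "continuous_on {0..T} w" and t0: "0 < t0" "t0 < T"
    and d: "(w has_vector_derivative d) (at t0)"
  shows "(\<lambda>N. fourier_sum T w N t0) \<longlonglongrightarrow> w t0"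
proof -
  have T: "T > 0" using t0 by simp
  define \<xi> where "\<xi> = freq T 1"
  have \<xi>: "\<xi> \<noteq> 0" using T by (simp add: \<xi>_def freq_def)
  define q where "q t = cis (\<xi> * (t - t0)) - 1" for t
  define g where "g t = (if t = t0 then (1 / (\<i> * of_real \<xi>)) *\<^sub>C d
      else (1 / q t) *\<^sub>C (w t - w t0))" for t
  \<comment> \<open>\<open>T\<close> is the least period of the denominator, and \<open>\<bar>t - t0\<bar> < T\<close> because \<open>t0\<close> is interior.\<close>
  have q0: "q t \<noteq> 0" if "t \<in> {0..T}" "t \<noteq> t0" for t
  proof
    assume "q t = 0"
    then have "cos (\<xi> * (t - t0)) = 1"
      by (simp add: q_def complex_eq_iff)
    then obtain k :: int where "\<xi> * (t - t0) = of_int k * 2 * pi"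
      using cos_one_2pi_int by blast
    then have "(2 * pi) * (t - t0) = (2 * pi) * (of_int k * T)"
      using T by (simp add: \<xi>_def freq_def divide_simps mult_ac)
    then have k: "t - t0 = of_int k * T"
      by (rule mult_left_cancel[THEN iffD1, rotated]) simp
    moreover have "\<bar>t - t0\<bar> < T" using that t0 by auto
    ultimately have "\<bar>of_int k :: real\<bar> * T < 1 * T" using T by (simp add: abs_mult)
    then have "k = 0" using T by (simp only: mult_less_cancel_right_pos)
    then show False using k that by simp
  qed
  have g: "continuous_on {0..T} g"
  proof -
    have "isCont g t0"
    proof -
      have 1: "((\<lambda>t. (1 / (t - t0)) *\<^sub>R (w t - w t0)) \<longlongrightarrow> d) (at t0)"
        using d by (simp only: has_vector_derivative_iff_quotient)
      have "((\<lambda>t. inverse ((1 / (t - t0)) *\<^sub>R q t) *\<^sub>C ((1 / (t - t0)) *\<^sub>R (w t - w t0))) \<longlongrightarrow>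
          inverse (\<i> * of_real \<xi>) *\<^sub>C d) (at t0)"
        unfolding q_def using \<xi>
        by (intro tendsto_scaleC tendsto_inverse cis_sub_1_quotient_tendsto 1) auto
      moreover have "\<forall>\<^sub>F t in at t0. inverse ((1 / (t - t0)) *\<^sub>R q t) *\<^sub>C ((1 / (t - t0)) *\<^sub>R (w t - w t0)) = g t"
        by (auto simp: eventually_at_filter g_def scaleC_scaleR scaleR_conv_of_real 
           scaleR_scaleC[where 'a='h] scaleC_scaleC field_simps)
      ultimately have "(g \<longlongrightarrow> inverse (\<i> * of_real \<xi>) *\<^sub>C d) (at t0)"
        by (rule Lim_transform_eventually)
      then show ?thesis by (simp add: isCont_def g_def inverse_eq_divide)
    qed
    moreover have "continuous (at t within {0..T}) g" if "t \<in> {0..T}" "t \<noteq> t0" for t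
    proof -
      have "continuous_on ({0..T} - {t0}) (\<lambda>t. (1 / q t) *\<^sub>C (w t - w t0))"
        using q0 by (intro continuous_intros continuous_on_scaleC continuous_on_subset[OF w])
          (auto simp: q_def intro!: continuous_intros)
      then have "continuous_on ({0..T} - {t0}) g"
        by (rule continuous_on_eq) (auto simp: g_def)
      then have "continuous (at t within {0..T} - {t0}) g"
        using that by (simp add: continuous_on_eq_continuous_within)
      moreover have "at t within {0..T} - {t0} = at t within {0..T}"
        using that by (intro at_within_nhd[of _ "- {t0}"]) auto
      ultimately show ?thesis by (simp add: continuous_within)
    qed
    ultimately show ?thesis
      unfolding continuous_on_eq_continuous_within by (metis continuous_at_imp_continuous_at_within)
  qed
  have shift: "freq T (n - 1) = freq T n - \<xi>" for n
    by (simp add: freq_diff \<xi>_def)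
  have coeff: "cis (freq T n * t0) *\<^sub>C fourier T w n
      = (cis (freq T (n-1) * t0) *\<^sub>C fourier T g (n - 1) - cis (freq T n * t0) *\<^sub>C fourier T g n)
        + (if n = 0 then T else 0) *\<^sub>R w t0" for n
  proof -
    have split: "cis (- (freq T n * s)) *\<^sub>C w s
        = (cis (- \<xi> * t0) *\<^sub>C cis (- (freq T (n - 1) * s)) *\<^sub>C g s - cis (- (freq T n * s)) *\<^sub>C g s)
          + cis (freq T (- n) * s) *\<^sub>C w t0" if "s \<in> {0..T}" for s
    proof -
      have "cis (- \<xi> * t0) *\<^sub>C cis (- (freq T (n - 1) * s)) *\<^sub>C g s - cis (- (freq T n * s)) *\<^sub>C g s
          = cis (- (freq T n * s)) *\<^sub>C q s *\<^sub>C g s"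
      proof -
        have "cis (- \<xi> * t0) * cis (- (freq T (n - 1) * s)) = cis (- (freq T n * s)) * cis (\<xi> * (s - t0))"
          unfolding cis_mult shift by (simp add: algebra_simps)
        then show ?thesis
          by (simp only: scaleC_scaleC q_def scaleC_diff_left scaleC_diff_right scaleC_one)
      qed
      moreover have "w s = w t0 + q s *\<^sub>C g s"
        using q0[OF that] by (simp add: g_def scaleC_scaleC scaleC_one q_def)
      moreover have "freq T (- n) * s = - (freq T n * s)" by (simp add: freq_def)
      ultimately show ?thesis by (simp only: scaleC_add_right add.commute)
    qed
    have "fourier T w n = integral {0..T} (\<lambda>s. (cis (- \<xi> * t0) *\<^sub>C cis (- (freq T (n - 1) * s)) *\<^sub>C g s - cis (- (freq T n * s)) *\<^sub>C g s)
          + cis (freq T (- n) * s) *\<^sub>C w t0)"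
      unfolding fourier_def by (rule integral_cong) (rule split)
    also have "\<dots> = (cis (- \<xi> * t0) *\<^sub>C fourier T g (n - 1) - fourier T g n)
        + (if - n = 0 then of_real T else 0) *\<^sub>C w t0"
    proof (intro integral_unique has_integral_add has_integral_diff)
      have G: "((\<lambda>s. cis (- (freq T n * s)) *\<^sub>C g s) has_integral fourier T g n) {0..T}" for n
        unfolding fourier_def by (intro integrable_integral integrable_cis_scaleC g)
      show "((\<lambda>s. cis (- (freq T n * s)) *\<^sub>C g s) has_integral fourier T g n) {0..T}"
        by (rule G)
      show "((\<lambda>s. cis (- \<xi> * t0) *\<^sub>C cis (- (freq T (n - 1) * s)) *\<^sub>C g s) has_integral
          cis (- \<xi> * t0) *\<^sub>C fourier T g (n - 1)) {0..T}"
        using has_integral_linear[OF G bounded_linear_scaleC_right] by (simp add: o_def)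
      show "((\<lambda>s. cis (freq T (- n) * s) *\<^sub>C w t0) has_integral
          (if - n = 0 then of_real T else 0) *\<^sub>C w t0) {0..T}"
        by (rule has_integral_cis_freq_scaleC[OF T])
    qed
    finally have w: "fourier T w n = \<dots>" .
    have "cis (freq T n * t0) * cis (- \<xi> * t0) = cis (freq T (n - 1) * t0)"
      by (simp add: cis_mult shift algebra_simps)
    moreover have "cis (freq T n * t0) *\<^sub>C (if - n = 0 then of_real T else 0) *\<^sub>C w t0
        = (if n = 0 then T else 0) *\<^sub>R w t0"
      by (auto simp: freq_def scaleC_one scaleR_scaleC)
    ultimately show ?thesis
      unfolding w scaleC_add_right scaleC_diff_right by (simp only: scaleC_scaleC)
  qed
  define G where "G n = cis (freq T n * t0) *\<^sub>C fourier T g n" for n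
  have sum: "fourier_sum T w N t0 = (1/T) *\<^sub>R (G (- int N - 1) - G (int N)) + w t0" for N
  proof -
    have "fourier_sum T w N t0 = (1/T) *\<^sub>R (\<Sum>n = - int N..int N. cis (freq T n * t0) *\<^sub>C fourier T w n)"
      by (simp add: fourier_sum_def scaleC_scaleR scaleR_sum_right)
    also have "\<dots> = (1/T) *\<^sub>R ((\<Sum>n = - int N..int N. G (n - 1) - G n)
        + (\<Sum>n = - int N..int N. (if n = 0 then T else 0) *\<^sub>R w t0))"
      by (simp add: coeff G_def sum.distrib)
    also have "(\<Sum>n = - int N..int N. (if n = 0 then T else 0) *\<^sub>R w t0) = T *\<^sub>R w t0"
      by (simp add: scaleR_left.sum[symmetric])
    finally have "fourier_sum T w N t0 = (1/T) *\<^sub>R ((G (- int N - 1) - G (int N)) + T *\<^sub>R w t0)"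
      by (simp only: sum_int_telescope[of G])
    then show ?thesis using T by (simp add: scaleR_add_right)
  qed
  have "(\<lambda>N. G (e N)) \<longlonglongrightarrow> 0" if "inj e" for e :: "nat \<Rightarrow> int"
    by (rule tendsto_norm_zero_cancel)
       (use tendsto_norm_zero[OF fourier_tendsto_0[OF T g that]] in \<open>simp add: G_def norm_scaleC\<close>)
  note this[of "\<lambda>N. - int N - 1"] this[of int]
  then have G0: "(\<lambda>N. G (- int N - 1)) \<longlonglongrightarrow> 0" "(\<lambda>N. G (int N)) \<longlonglongrightarrow> 0"
    by (simp_all add: inj_on_def)
  have "(\<lambda>N. (1/T) *\<^sub>R (G (- int N - 1) - G (int N)) + w t0) \<longlonglongrightarrow> (1/T) *\<^sub>R (0 - 0) + w t0"
    by (intro tendsto_add tendsto_scaleR tendsto_diff tendsto_const G0)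
  then show ?thesis by (simp add: sum)
qed

lemma has_integral_norm_fourier_sum:
  fixes w :: "real \<Rightarrow> 'h::complex_hilbert"
  assumes T: "T > 0"
  shows "((\<lambda>s. (norm (fourier_sum T w N s))\<^sup>2) has_integral
      (\<Sum>n = - int N..int N. (norm (fourier T w n))\<^sup>2) / T) {0..T}"
proof -
  have "T * (\<Sum>n = - int N..int N. (norm ((1/T) *\<^sub>R fourier T w n))\<^sup>2) =
      (\<Sum>n = - int N..int N. (norm (fourier T w n))\<^sup>2) / T"
  proof -
    have "T * (norm ((1/T) *\<^sub>R fourier T w n))\<^sup>2 = (norm (fourier T w n))\<^sup>2 / T" for n
      using T by (simp add: power_divide) (simp add: power2_eq_square)
    then show ?thesis by (simp only: sum_distrib_left sum_divide_distrib)
  qed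
  then show ?thesis
    using has_integral_norm_trig_poly[OF T, of "{- int N..int N}" "\<lambda>n. (1/T) *\<^sub>R fourier T w n"]
    by (simp only: fourier_sum_def finite_atLeastAtMost_int)
qed

text \<open>The half of Parseval's identity that says that the Fourier series captures all of \<open>w\<close>. The partial
sums converge to \<open>w\<close> off a finite set; cutting their squared norms off at \<open>\<bar>w\<bar>\<^sup>2\<close> turns the Fatou
type argument into dominated convergence.\<close>

lemma parseval_le:
  fixes w :: "real \<Rightarrow> 'h::complex_hilbert"
  assumes T: "T > 0" and w: "continuous_on {0..T} w" and F: "finite F"
    and d: "\<And>t. t \<in> {0<..<T} - F \<Longrightarrow> (w has_vector_derivative w' t) (at t)"
    and B: "\<And>N. (\<Sum>n = - int N..int N. (norm (fourier T w n))\<^sup>2) \<le> B"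
  shows "T * integral {0..T} (\<lambda>s. (norm (w s))\<^sup>2) \<le> B"
proof -
  define E where "E = insert 0 (insert T F)"
  have neg: "negligible E" using F by (simp add: E_def negligible_finite)
  have cS: "continuous_on {0..T} (fourier_sum T w N)" for N
    unfolding fourier_sum_def by (intro continuous_on_sum continuous_on_scaleC continuous_intros)
  define f where "f N s = min ((norm (fourier_sum T w N s))\<^sup>2) ((norm (w s))\<^sup>2)" for N s
  have cf: "continuous_on {0..T} (f N)" for N
    unfolding f_def by (intro continuous_intros cS w)
  have cw: "continuous_on {0..T} (\<lambda>s. (norm (w s))\<^sup>2)" by (intro continuous_intros w)
  have spike: "integral ({0..T} - E) h = integral {0..T} h" for h :: "real \<Rightarrow> real"
    by (rule integral_spike_set) (auto intro: negligible_subset[OF neg])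
  have spike': "h integrable_on {0..T} - E" if "continuous_on {0..T} h" for h :: "real \<Rightarrow> real"
    by (rule integrable_spike_set[OF integrable_continuous_real[OF that]]) (auto intro: negligible_subset[OF neg])
  have "(\<lambda>N. integral ({0..T} - E) (f N)) \<longlonglongrightarrow> integral ({0..T} - E) (\<lambda>s. (norm (w s))\<^sup>2)"
  proof (rule dominated_convergence(2))
    show "f N integrable_on {0..T} - E" for N by (rule spike'[OF cf])
    show "(\<lambda>s. (norm (w s))\<^sup>2) integrable_on {0..T} - E" by (rule spike'[OF cw])
    show "norm (f N s) \<le> (norm (w s))\<^sup>2" for N s by (auto simp: f_def)
    show "(\<lambda>N. f N s) \<longlonglongrightarrow> (norm (w s))\<^sup>2" if "s \<in> {0..T} - E" for s
    proof -
      have "s \<in> {0<..<T} - F" using that by (auto simp: E_def)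
      then have "(\<lambda>N. fourier_sum T w N s) \<longlonglongrightarrow> w s"
        using fourier_sum_tendsto[OF w _ _ d] by auto
      then have "(\<lambda>N. f N s) \<longlonglongrightarrow> min ((norm (w s))\<^sup>2) ((norm (w s))\<^sup>2)"
        unfolding f_def by (intro tendsto_intros)
      then show ?thesis by simp
    qed
  qed
  then have "(\<lambda>N. integral {0..T} (f N)) \<longlonglongrightarrow> integral {0..T} (\<lambda>s. (norm (w s))\<^sup>2)"
    by (simp add: spike)
  moreover have "integral {0..T} (f N) \<le> B / T" for N
  proof -
    have "integral {0..T} (f N) \<le> (\<Sum>n = - int N..int N. (norm (fourier T w n))\<^sup>2) / T"
      by (rule has_integral_le[OF integrable_integral[OF integrable_continuous_real[OF cf]]
            has_integral_norm_fourier_sum[OF T]]) (auto simp: f_def)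
    also have "\<dots> \<le> B / T" using B T by (intro divide_right_mono) auto
    finally show ?thesis .
  qed
  ultimately have "integral {0..T} (\<lambda>s. (norm (w s))\<^sup>2) \<le> B / T"
    by (intro LIMSEQ_le_const2) auto
  then show ?thesis using T by (simp add: field_simps)
qed

section \<open>The energy inequality\<close>

text \<open>Here \<open>R \<xi>\<close> stands for the resolvent at \<open>\<omega> + \<i> \<xi>\<close>, and the hypothesis on \<open>p\<close> is the equation
\<open>p' = (A - \<omega>) p\<close> written without the unbounded operator. Integration by parts against
\<open>cis (- \<xi> s)\<close> turns it into \<open>fourier (\<Phi> p) = R (fourier (\<Phi>' p))\<close>. The integral is named \<open>J\<close> so that
the integrability of \<open>\<Phi>'\<^sup>2 \<bar>p\<bar>\<^sup>2\<close> and the splitting of the integral at the breakpoints are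
obtained together.\<close>

lemma energy_inequality:
  fixes p p' :: "real \<Rightarrow> 'h::complex_hilbert" and \<Phi> \<phi> :: "real \<Rightarrow> real"
  assumes T: "T > 0" and r: "r > 0"
    and p: "\<And>s. s \<in> {0..T} \<Longrightarrow> (p has_vector_derivative p' s) (at s within {0..T})"
    and p': "continuous_on {0..T} p'"
    and lin: "\<And>\<xi>. bounded_clinear (R \<xi>)"
    and R: "\<And>\<xi> x. norm (R \<xi> x) \<le> norm x / r"
    and eq: "\<And>\<xi> s. s \<in> {0..T} \<Longrightarrow> p s = R \<xi> ((\<i> * of_real \<xi>) *\<^sub>C p s - p' s)"
    and F: "finite F" and \<Phi>: "continuous_on {0..T} \<Phi>"
    and \<phi>: "\<And>s. s \<in> {0<..<T} - F \<Longrightarrow> (\<Phi> has_vector_derivative \<phi> s) (at s)"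
    and ends: "\<Phi> 0 = 0" "\<Phi> T = 0"
    and J: "((\<lambda>s. ((\<phi> s)\<^sup>2 - r\<^sup>2 * (\<Phi> s)\<^sup>2) * (norm (p s))\<^sup>2) has_integral J) {0..T}"
  shows "0 \<le> J"
proof -
  have cp: "continuous_on {0..T} p"
    unfolding continuous_on_eq_continuous_within by (blast intro: p has_vector_derivative_continuous)
  define w where "w s = \<Phi> s *\<^sub>R p s" for s
  define v where "v s = \<phi> s *\<^sub>R p s" for s
  have cw: "continuous_on {0..T} w" unfolding w_def by (intro continuous_intros \<Phi> cp)
  have dp: "(p has_vector_derivative p' s) (at s)" if "s \<in> {0<..<T} - F" for s
    using p[of s] that at_within_Icc_at[of 0 s T] by auto
  have dw: "(w has_vector_derivative v s + \<Phi> s *\<^sub>R p' s) (at s)" if "s \<in> {0<..<T} - F" for s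
    unfolding w_def v_def
    using has_vector_derivative_scaleR[OF _ dp[OF that], of \<Phi> "\<phi> s"] \<phi>[OF that]
    by (simp add: has_real_derivative_iff_has_vector_derivative add.commute)
  have coeff: "(\<lambda>s. cis (- (freq T n * s)) *\<^sub>C v s) integrable_on {0..T} \<and>
      fourier T w n = R (freq T n) (fourier T v n)" for n
  proof -
    define \<xi> where "\<xi> = freq T n"
    define e where "e s = cis (- (\<xi> * s))" for s
    define h where "h s = e s *\<^sub>C (\<Phi> s *\<^sub>R ((\<i> * of_real \<xi>) *\<^sub>C p s - p' s))" for s
    have bl: "bounded_linear (R \<xi>)" and sc: "R \<xi> (c *\<^sub>C x) = c *\<^sub>C R \<xi> x" for c x
      using lin[of \<xi>] by (auto simp: bounded_clinear_def)
    have de: "(e has_vector_derivative - (\<i> * of_real \<xi>) * e s) (at s)" for s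
    proof -
      have "((\<lambda>z. exp (- (\<i> * of_real \<xi> * z))) has_field_derivative
          - (\<i> * of_real \<xi>) * exp (- (\<i> * of_real \<xi> * of_real s))) (at (of_real s))"
        by (auto intro!: derivative_eq_intros)
      from has_vector_derivative_real_field[OF this] show ?thesis
        by (simp add: e_def[abs_def] cis_conv_exp mult.assoc)
    qed
    have ch: "continuous_on {0..T} h"
      unfolding h_def e_def by (intro continuous_on_scaleC continuous_intros \<Phi> cp p')
    have hi: "(h has_integral integral {0..T} h) {0..T}"
      by (rule integrable_integral[OF integrable_continuous_real[OF ch]])
    \<comment> \<open>Integration by parts. It also proves that \<open>e v\<close> is integrable although \<open>v\<close> may jump.\<close>
    have "((\<lambda>s. e s *\<^sub>C v s - h s) has_integral e T *\<^sub>C w T - e 0 *\<^sub>C w 0) {0..T}"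
    proof (rule fundamental_theorem_of_calculus_interior_strong[OF F])
      show "continuous_on {0..T} (\<lambda>s. e s *\<^sub>C w s)"
        unfolding e_def by (intro continuous_on_scaleC continuous_intros cw)
      fix s assume s: "s \<in> {0<..<T} - F"
      have "((\<lambda>s. e s *\<^sub>C w s) has_vector_derivative
          e s *\<^sub>C (v s + \<Phi> s *\<^sub>R p' s) + (- (\<i> * of_real \<xi>) * e s) *\<^sub>C w s) (at s)"
        by (rule bounded_bilinear.has_vector_derivative[OF bounded_bilinear_scaleC de dw[OF s]])
      moreover have "e s *\<^sub>C (v s + \<Phi> s *\<^sub>R p' s) + (- (\<i> * of_real \<xi>) * e s) *\<^sub>C w s = e s *\<^sub>C v s - h s"
        by (simp add: h_def w_def scaleC_add_right scaleC_diff_right scaleR_diff_right scaleC_scaleR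
            scaleC_minus_left scaleC_scaleC mult.commute)
      ultimately show "((\<lambda>s. e s *\<^sub>C w s) has_vector_derivative e s *\<^sub>C v s - h s) (at s)" by simp
    qed (use T in simp)
    then have "((\<lambda>s. e s *\<^sub>C v s - h s) has_integral 0) {0..T}"
      by (simp add: w_def ends)
    from has_integral_add[OF this hi] have vi: "((\<lambda>s. e s *\<^sub>C v s) has_integral integral {0..T} h) {0..T}"
      by simp
    have "((\<lambda>s. R \<xi> (h s)) has_integral R \<xi> (integral {0..T} h)) {0..T}"
      using has_integral_linear[OF hi bl] by (simp add: o_def)
    moreover have "R \<xi> (h s) = e s *\<^sub>C w s" if "s \<in> {0..T}" for s
      using eq[OF that, of \<xi>] by (simp add: h_def w_def sc scaleC_scaleR scaleR_scaleC[where 'a='h])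
    ultimately have "((\<lambda>s. e s *\<^sub>C w s) has_integral R \<xi> (integral {0..T} h)) {0..T}"
      by (subst (asm) has_integral_cong[where g = "\<lambda>s. e s *\<^sub>C w s"]) auto
    with vi show ?thesis
      by (auto simp: fourier_def e_def \<xi>_def integral_unique has_integral_integrable)
  qed
  have iw: "((\<lambda>s. (norm (w s))\<^sup>2) has_integral integral {0..T} (\<lambda>s. (norm (w s))\<^sup>2)) {0..T}"
    by (intro integrable_integral integrable_continuous_real continuous_intros cw)
  have iv: "((\<lambda>s. (norm (v s))\<^sup>2) has_integral J + r\<^sup>2 * integral {0..T} (\<lambda>s. (norm (w s))\<^sup>2)) {0..T}"
    using has_integral_add[OF J has_integral_mult_right[OF iw, of "r\<^sup>2"]]
    by (simp add: v_def w_def power_mult_distrib algebra_simps)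
  have "T * integral {0..T} (\<lambda>s. (norm (w s))\<^sup>2) \<le>
      T * (J + r\<^sup>2 * integral {0..T} (\<lambda>s. (norm (w s))\<^sup>2)) / r\<^sup>2"
  proof (rule parseval_le[OF T cw F dw])
    fix N
    have "(\<Sum>n = - int N..int N. (norm (fourier T w n))\<^sup>2) \<le>
        (\<Sum>n = - int N..int N. (norm (fourier T v n))\<^sup>2 / r\<^sup>2)"
    proof (rule sum_mono)
      fix n
      have "norm (fourier T w n) \<le> norm (fourier T v n) / r" using coeff[of n] R by simp
      then show "(norm (fourier T w n))\<^sup>2 \<le> (norm (fourier T v n))\<^sup>2 / r\<^sup>2"
        using power_mono[of "norm (fourier T w n)" "norm (fourier T v n) / r" 2]
        by (simp add: power_divide)
    qed
    also have "\<dots> \<le> T * (J + r\<^sup>2 * integral {0..T} (\<lambda>s. (norm (w s))\<^sup>2)) / r\<^sup>2"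
      using bessel_inequality[OF T _ _ has_integral_integrable[OF iv], of "{- int N..int N}"] coeff
      by (simp add: sum_divide_distrib[symmetric] integral_unique[OF iv] divide_right_mono)
    finally show "(\<Sum>n = - int N..int N. (norm (fourier T w n))\<^sup>2) \<le>
        T * (J + r\<^sup>2 * integral {0..T} (\<lambda>s. (norm (w s))\<^sup>2)) / r\<^sup>2" .
  qed
  then have "0 \<le> T * J" using r by (simp add: field_simps)
  then show ?thesis using T by (simp add: zero_le_mult_iff)
qed

section \<open>From the energy inequality to decay\<close>

lemma continuous_on_glue:
  fixes f g :: "real \<Rightarrow> 'a::topological_space"
  assumes "continuous_on {l..m} f" "continuous_on {m..u} g" "f m = g m"
  shows "continuous_on {l..u} (\<lambda>s. if s \<le> m then f s else g s)"
  by (rule continuous_on_cases_le)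
     (use assms in \<open>auto intro: continuous_on_subset\<close>)

lemma has_integral_glue:
  fixes f g :: "real \<Rightarrow> 'a::banach"
  assumes "(f has_integral i) {l..m}" "(g has_integral j) {m..u}" "l \<le> m" "m \<le> u"
  shows "((\<lambda>s. if s \<le> m then f s else g s) has_integral i + j) {l..u}"
proof (rule has_integral_combine)
  show "((\<lambda>s. if s \<le> m then f s else g s) has_integral i) {l..m}"
    by (rule has_integral_eq[OF _ assms(1)]) simp
  show "((\<lambda>s. if s \<le> m then f s else g s) has_integral j) {m..u}"
    by (rule has_integral_spike_finite[OF _ _ assms(2), of "{m}"]) auto
qed (use assms in auto)

lemma has_integral_reflect_shift:
  fixes h :: "real \<Rightarrow> real"
  assumes h: "continuous_on {0..b} h" and b: "b \<ge> 0"
  shows "((\<lambda>s. h (t - s)) has_integral integral {0..b} h) {t - b..t}"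
proof -
  define H where "H s = integral {0..s} h" for s
  have H: "(H has_vector_derivative h s) (at s within {0..b})" if "s \<in> {0..b}" for s
    unfolding H_def using integral_has_vector_derivative[OF h that] .
  have "((\<lambda>s. h (t - s)) has_integral (- H (t - t)) - (- H (t - (t - b)))) {t - b..t}"
  proof (rule fundamental_theorem_of_calculus)
    fix s assume s: "s \<in> {t - b..t}"
    have "(\<lambda>s. t - s) ` {t - b..t} \<subseteq> {0..b}" by auto
    then have "((H \<circ> (\<lambda>s. t - s)) has_vector_derivative (- 1) *\<^sub>R h (t - s)) (at s within {t - b..t})"
      using s by (intro vector_diff_chain_within has_vector_derivative_within_subset[OF H])
        (auto intro!: derivative_eq_intros)
    from has_vector_derivative_minus[OF this]
    show "((\<lambda>s. - H (t - s)) has_vector_derivative h (t - s)) (at s within {t - b..t})"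
      by (simp add: o_def)
  qed (use b in simp)
  then show ?thesis by (simp add: H_def)
qed

text \<open>The choice of \<open>\<Phi>\<close>. In the application \<open>u\<close> is the norm of the rescaled orbit and \<open>g\<close> is the
rescaled \<open>1 / m\<close>. With \<open>c = exp (r * (t - a - b))\<close> the value of \<open>\<Phi>\<close> on the plateau, the four
pieces of the integral are at most \<open>N\<^sup>2 / G a\<close>, equal to 0, at most \<open>- r\<^sup>2 * c\<^sup>2 * (u t)\<^sup>2 * G b\<close>, and
an error that tends to 0 with the length \<open>\<tau>\<close> of the last interval. The growth rate \<open>r / 2\<close>
stands for any rate below \<open>r\<close>.\<close>

lemma weighted_decay_from_energy:
  fixes u g :: "real \<Rightarrow> real"
  assumes r: "r > 0" and a: "a > 0" and b: "b > 0" and t: "t > a + b"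
    and u: "continuous_on {0..} u" and u0: "\<And>s. s \<ge> 0 \<Longrightarrow> u s \<ge> 0"
    and g: "continuous_on {0..} g" and g0: "\<And>s. s \<ge> 0 \<Longrightarrow> g s > 0"
    and energy: "\<And>T \<Phi> \<phi> F J. T > 0 \<Longrightarrow> finite F \<Longrightarrow> continuous_on {0..T} \<Phi> \<Longrightarrow>
      (\<And>s. s \<in> {0<..<T} - F \<Longrightarrow> (\<Phi> has_vector_derivative \<phi> s) (at s)) \<Longrightarrow>
      \<Phi> 0 = 0 \<Longrightarrow> \<Phi> T = 0 \<Longrightarrow>
      ((\<lambda>s. ((\<phi> s)\<^sup>2 - r\<^sup>2 * (\<Phi> s)\<^sup>2) * (u s)\<^sup>2) has_integral J) {0..T} \<Longrightarrow> 0 \<le> J"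
    and initial: "\<And>s. s \<in> {0..a} \<Longrightarrow> u s * g s \<le> N"
    and final: "\<And>s. s \<in> {t - b..t} \<Longrightarrow> u t * g (t - s) \<le> u s"
    and growth: "\<And>s. s \<ge> 0 \<Longrightarrow> u s \<le> K * exp (r / 2 * s)"
  shows "r * exp (r * (t - a - b)) * sqrt (integral {0..a} (\<lambda>s. (g s)\<^sup>2)) *
      sqrt (integral {0..b} (\<lambda>s. (g s)\<^sup>2)) * u t \<le> N"
proof -
  define G where "G s = integral {0..s} (\<lambda>s. (g s)\<^sup>2)" for s
  define c where "c = exp (r * (t - a - b))"
  have cg2: "continuous_on {0..L} (\<lambda>s. (g s)\<^sup>2)" for L
    by (intro continuous_intros continuous_on_subset[OF g]) auto
  have cu2: "continuous_on {l..L} (\<lambda>s. (u s)\<^sup>2)" if "0 \<le> l" for l L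
    using that by (intro continuous_intros continuous_on_subset[OF u]) auto
  have Gpos: "G L > 0" if "L > 0" for L
  proof -
    have "G L \<noteq> 0"
      using integral_eq_0_iff[OF cg2 that] g0[of L] that unfolding G_def by force
    moreover have "G L \<ge> 0" unfolding G_def by (intro integral_nonneg integrable_continuous_real cg2) auto
    ultimately show ?thesis by simp
  qed
  have N0: "N \<ge> 0" using initial[of 0] u0[of 0] g0[of 0] a
    by (meson atLeastAtMost_iff less_eq_real_def mult_nonneg_nonneg order_refl order_trans)
  have bound: "r\<^sup>2 * c\<^sup>2 * (u t)\<^sup>2 * G b \<le> N\<^sup>2 / G a +
      r\<^sup>2 * c\<^sup>2 * K\<^sup>2 * exp (r * t) * (exp (r * \<tau>) * \<tau> / (sinh (r * \<tau>))\<^sup>2)" if \<tau>: "\<tau> > 0" for \<tau>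
  proof -
    define T where "T = t + \<tau>"
    define q where "q = sinh (r * \<tau>)"
    have q: "q > 0" using r \<tau> by (simp add: q_def)
    have T: "T > t" using \<tau> by (simp add: T_def)
    define \<Phi> where "\<Phi> s = (if s \<le> a then G s / G a else if s \<le> t - b then exp (r * (s - a))
        else if s \<le> t then c else c * sinh (r * (T - s)) / q)" for s
    define \<phi> where "\<phi> s = (if s \<le> a then (g s)\<^sup>2 / G a else if s \<le> t - b then r * exp (r * (s - a))
        else if s \<le> t then 0 else - (c * r * cosh (r * (T - s)) / q))" for s
    have dG: "(G has_vector_derivative (g s)\<^sup>2) (at s within {0..L})" if "s \<in> {0..L}" for s L
      unfolding G_def using integral_has_vector_derivative[OF cg2 that] .
    have c\<Phi>: "continuous_on {0..T} \<Phi>"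
      unfolding \<Phi>_def
    proof (intro continuous_on_glue)
      show "continuous_on {0..a} (\<lambda>s. G s / G a)"
        unfolding G_def using Gpos[OF a]
        by (intro continuous_intros indefinite_integral_continuous_1 integrable_continuous_real cg2)
           (auto simp: G_def)
      show "continuous_on {t..T} (\<lambda>s. c * sinh (r * (T - s)) / q)"
        using q by (intro continuous_intros) auto
    qed (use Gpos[OF a] t b q in \<open>auto intro!: continuous_intros simp: c_def T_def q_def algebra_simps\<close>)
    have d\<Phi>: "(\<Phi> has_vector_derivative \<phi> s) (at s)" if s: "s \<in> {0<..<T} - {a, t - b, t}" for s
    proof -
      consider "0 < s" "s < a" | "a < s" "s < t - b" | "t - b < s" "s < t" | "t < s" "s < T"
        using s by fastforce
      then show ?thesis
      proof cases
        case 1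
        have "(G has_vector_derivative (g s)\<^sup>2) (at s)"
          using dG[of s a] 1 at_within_Icc_at[of 0 s a] by auto
        then have "((\<lambda>s. G s / G a) has_vector_derivative \<phi> s) (at s)"
          using 1 has_vector_derivative_divide[of G "(g s)\<^sup>2" "at s" "G a"] by (simp add: \<phi>_def)
        then show ?thesis
          by (rule has_vector_derivative_transform_within_open[of _ _ _ "{0<..<a}"])
             (use 1 in \<open>auto simp: \<Phi>_def\<close>)
      next
        case 2
        have "((\<lambda>s. exp (r * (s - a))) has_vector_derivative \<phi> s) (at s)"
          using 2 t b unfolding has_real_derivative_iff_has_vector_derivative[symmetric]
          by (auto intro!: derivative_eq_intros simp: \<phi>_def)
        then show ?thesis
          by (rule has_vector_derivative_transform_within_open[of _ _ _ "{a<..<t - b}"])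
             (use 2 in \<open>auto simp: \<Phi>_def\<close>)
      next
        case 3
        have "((\<lambda>s. c) has_vector_derivative \<phi> s) (at s)"
          using 3 t b by (simp add: \<phi>_def)
        then show ?thesis
          by (rule has_vector_derivative_transform_within_open[of _ _ _ "{t - b<..<t}"])
             (use 3 t in \<open>auto simp: \<Phi>_def\<close>)
      next
        case 4
        have "((\<lambda>s. c * sinh (r * (T - s)) / q) has_vector_derivative \<phi> s) (at s)"
          using 4 t b q unfolding has_real_derivative_iff_has_vector_derivative[symmetric]
          by (auto intro!: derivative_eq_intros simp: \<phi>_def)
        then show ?thesis
          by (rule has_vector_derivative_transform_within_open[of _ _ _ "{t<..<T}"])
             (use 4 t b in \<open>auto simp: \<Phi>_def\<close>)
      qed
    qed
    \<comment> \<open>The integrand on the first and last intervals. On the last one \<open>cosh\<^sup>2 - sinh\<^sup>2 = 1\<close>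
      makes the coefficient of \<open>(u s)\<^sup>2\<close> constant; in between it is \<open>0\<close> and then \<open>- (r\<^sup>2 * c\<^sup>2)\<close>.\<close>
    define e1 where "e1 s = (((g s)\<^sup>2 / G a)\<^sup>2 - r\<^sup>2 * (G s / G a)\<^sup>2) * (u s)\<^sup>2" for s
    define e4 where "e4 s = (r\<^sup>2 * c\<^sup>2 / q\<^sup>2) * (u s)\<^sup>2" for s
    have cG: "continuous_on {0..a} G"
      unfolding G_def by (intro indefinite_integral_continuous_1 integrable_continuous_real cg2)
    have i1: "(e1 has_integral integral {0..a} e1) {0..a}"
      unfolding e1_def power_divide using Gpos[OF a]
      by (intro integrable_integral integrable_continuous_real continuous_intros cg2 cu2 cG) auto
    have i3: "((\<lambda>s. - (r\<^sup>2 * c\<^sup>2) * (u s)\<^sup>2) has_integral - (r\<^sup>2 * c\<^sup>2) * integral {t - b..t} (\<lambda>s. (u s)\<^sup>2)) {t - b..t}"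
      using a t by (intro has_integral_mult_right integrable_integral integrable_continuous_real cu2) auto
    have i4: "(e4 has_integral (r\<^sup>2 * c\<^sup>2 / q\<^sup>2) * integral {t..T} (\<lambda>s. (u s)\<^sup>2)) {t..T}"
      unfolding e4_def using a b t
      by (intro has_integral_mult_right integrable_integral integrable_continuous_real cu2) auto
    have eq: "((\<phi> s)\<^sup>2 - r\<^sup>2 * (\<Phi> s)\<^sup>2) * (u s)\<^sup>2 = (if s \<le> a then e1 s else if s \<le> t - b then 0
        else if s \<le> t then - (r\<^sup>2 * c\<^sup>2) * (u s)\<^sup>2 else e4 s)" for s
    proof -
      have "(c * r * cosh x / q)\<^sup>2 - r\<^sup>2 * (c * sinh x / q)\<^sup>2 = r\<^sup>2 * c\<^sup>2 / q\<^sup>2" for x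
        using q by (simp add: power_mult_distrib power_divide cosh_square_eq field_simps)
      then show ?thesis
        by (simp add: \<Phi>_def \<phi>_def e1_def e4_def power_mult_distrib)
    qed
    have "0 \<le> integral {0..a} e1 + (0 + (- (r\<^sup>2 * c\<^sup>2) * integral {t - b..t} (\<lambda>s. (u s)\<^sup>2)
        + (r\<^sup>2 * c\<^sup>2 / q\<^sup>2) * integral {t..T} (\<lambda>s. (u s)\<^sup>2)))"
    proof (rule energy[where F = "{a, t - b, t}", OF _ _ c\<Phi> d\<Phi>])
      show "((\<lambda>s. ((\<phi> s)\<^sup>2 - r\<^sup>2 * (\<Phi> s)\<^sup>2) * (u s)\<^sup>2) has_integral integral {0..a} e1 +
          (0 + (- (r\<^sup>2 * c\<^sup>2) * integral {t - b..t} (\<lambda>s. (u s)\<^sup>2)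
          + (r\<^sup>2 * c\<^sup>2 / q\<^sup>2) * integral {t..T} (\<lambda>s. (u s)\<^sup>2)))) {0..T}"
        unfolding eq using a b t T by (intro has_integral_glue i1 i3 i4 has_integral_0) auto
    qed (use a b t T in \<open>auto simp: \<Phi>_def G_def\<close>)
    moreover have "integral {0..a} e1 \<le> N\<^sup>2 / (G a)\<^sup>2 * G a"
    proof (rule has_integral_le[OF i1])
      show "((\<lambda>s. N\<^sup>2 / (G a)\<^sup>2 * (g s)\<^sup>2) has_integral N\<^sup>2 / (G a)\<^sup>2 * G a) {0..a}"
        unfolding G_def by (intro has_integral_mult_right integrable_integral integrable_continuous_real cg2)
      fix s assume s: "s \<in> {0..a}"
      have "(u s * g s)\<^sup>2 \<le> N\<^sup>2"
        using initial[OF s] u0[of s] g0[of s] s by (intro power_mono) auto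
      then have "(u s * g s)\<^sup>2 * ((g s)\<^sup>2 / (G a)\<^sup>2) \<le> N\<^sup>2 * ((g s)\<^sup>2 / (G a)\<^sup>2)"
        by (rule mult_right_mono) simp
      moreover have "e1 s \<le> ((g s)\<^sup>2 / G a)\<^sup>2 * (u s)\<^sup>2"
        unfolding e1_def by (intro mult_right_mono) auto
      moreover have "((g s)\<^sup>2 / G a)\<^sup>2 * (u s)\<^sup>2 = (u s * g s)\<^sup>2 * ((g s)\<^sup>2 / (G a)\<^sup>2)"
        by (simp add: power_mult_distrib power_divide)
      ultimately show "e1 s \<le> N\<^sup>2 / (G a)\<^sup>2 * (g s)\<^sup>2" by simp
    qed
    moreover have "(u t)\<^sup>2 * G b \<le> integral {t - b..t} (\<lambda>s. (u s)\<^sup>2)"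
    proof (rule has_integral_le)
      show "((\<lambda>s. (u t)\<^sup>2 * (g (t - s))\<^sup>2) has_integral (u t)\<^sup>2 * G b) {t - b..t}"
        unfolding G_def using b by (intro has_integral_mult_right has_integral_reflect_shift cg2) auto
      show "((\<lambda>s. (u s)\<^sup>2) has_integral integral {t - b..t} (\<lambda>s. (u s)\<^sup>2)) {t - b..t}"
        using a t by (intro integrable_integral integrable_continuous_real cu2) auto
      show "(u t)\<^sup>2 * (g (t - s))\<^sup>2 \<le> (u s)\<^sup>2" if s: "s \<in> {t - b..t}" for s
        using power_mono[OF final[OF s], of 2] u0[of t] g0[of "t - s"] s a b t
        by (auto simp: power_mult_distrib)
    qed
    moreover have "integral {t..T} (\<lambda>s. (u s)\<^sup>2) \<le> K\<^sup>2 * exp (r * T) * \<tau>"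
    proof -
      have "integral {t..T} (\<lambda>s. (u s)\<^sup>2) \<le> integral {t..T} (\<lambda>s. K\<^sup>2 * exp (r * T))"
      proof (rule integral_le)
        show "(\<lambda>s. (u s)\<^sup>2) integrable_on {t..T}"
          using a b t by (intro integrable_continuous_real cu2) auto
        fix s assume s: "s \<in> {t..T}"
        have "(u s)\<^sup>2 \<le> (K * exp (r / 2 * s))\<^sup>2"
          using growth[of s] u0[of s] s a b t by (intro power_mono) auto
        also have "\<dots> = K\<^sup>2 * exp (r * s)"
          by (simp add: power_mult_distrib exp_double[symmetric] flip: exp_of_nat_mult)
        also have "\<dots> \<le> K\<^sup>2 * exp (r * T)"
          using s r by (intro mult_left_mono) auto
        finally show "(u s)\<^sup>2 \<le> K\<^sup>2 * exp (r * T)" .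
      qed auto
      then show ?thesis using T by (simp add: T_def mult_ac)
    qed
    ultimately have *: "0 \<le> integral {0..a} e1 + (0 + (- (r\<^sup>2 * c\<^sup>2) * integral {t - b..t} (\<lambda>s. (u s)\<^sup>2)
        + (r\<^sup>2 * c\<^sup>2 / q\<^sup>2) * integral {t..T} (\<lambda>s. (u s)\<^sup>2)))"
      "integral {0..a} e1 \<le> N\<^sup>2 / (G a)\<^sup>2 * G a"
      and "(u t)\<^sup>2 * G b \<le> integral {t - b..t} (\<lambda>s. (u s)\<^sup>2)"
      and "integral {t..T} (\<lambda>s. (u s)\<^sup>2) \<le> K\<^sup>2 * exp (r * T) * \<tau>"
      by auto
    have "(r\<^sup>2 * c\<^sup>2) * ((u t)\<^sup>2 * G b) \<le> (r\<^sup>2 * c\<^sup>2) * integral {t - b..t} (\<lambda>s. (u s)\<^sup>2)"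
      by (rule mult_left_mono) (fact, simp)
    moreover have "(r\<^sup>2 * c\<^sup>2 / q\<^sup>2) * integral {t..T} (\<lambda>s. (u s)\<^sup>2) \<le> (r\<^sup>2 * c\<^sup>2 / q\<^sup>2) * (K\<^sup>2 * exp (r * T) * \<tau>)"
      by (rule mult_left_mono) (fact, simp)
    ultimately have "(r\<^sup>2 * c\<^sup>2) * ((u t)\<^sup>2 * G b) \<le> N\<^sup>2 / (G a)\<^sup>2 * G a + (r\<^sup>2 * c\<^sup>2 / q\<^sup>2) * (K\<^sup>2 * exp (r * T) * \<tau>)"
      using * unfolding mult_minus_left by linarith
    then show ?thesis
      using Gpos[OF a] by (simp add: q_def T_def distrib_left exp_add mult_ac power2_eq_square[of "G a"])
  qed
  have "((\<lambda>\<tau>. exp (r * \<tau>) * \<tau> / (sinh (r * \<tau>))\<^sup>2) \<longlongrightarrow> 0) at_top"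
    using r by real_asymp
  then have "((\<lambda>\<tau>. N\<^sup>2 / G a + r\<^sup>2 * c\<^sup>2 * K\<^sup>2 * exp (r * t) * (exp (r * \<tau>) * \<tau> / (sinh (r * \<tau>))\<^sup>2))
      \<longlongrightarrow> N\<^sup>2 / G a + r\<^sup>2 * c\<^sup>2 * K\<^sup>2 * exp (r * t) * 0) at_top"
    by (intro tendsto_intros)
  then have "r\<^sup>2 * c\<^sup>2 * (u t)\<^sup>2 * G b \<le> N\<^sup>2 / G a"
    using bound by (intro tendsto_lowerbound) (auto intro: eventually_mono[OF eventually_gt_at_top[of 0]])
  then have "(r * c * sqrt (G a) * sqrt (G b) * u t)\<^sup>2 \<le> N\<^sup>2"
    using Gpos[OF a] Gpos[OF b] by (simp add: power_mult_distrib field_simps)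
  then show ?thesis
    using N0 unfolding G_def c_def by (rule power2_le_imp_le)
qed

section \<open>Orbits of the semigroup\<close>

lemma C0_semigroupD:
  assumes "C0_semigroup S"
  shows "\<And>t. t \<ge> 0 \<Longrightarrow> bounded_linear (S t)"
    and "\<And>s t x. s \<ge> 0 \<Longrightarrow> t \<ge> 0 \<Longrightarrow> S (s + t) x = S s (S t x)"
    and "S 0 x = x"
    and "\<And>x. continuous_on {0..} (\<lambda>t. S t x)"
  using assms by (auto simp: C0_semigroup_def bounded_clinear_def)

text \<open>The vectors \<open>orbit_integral S x k\<close> with \<open>k > 0\<close> are dense (\<open>orbit_integral_average_tendsto\<close>) and their
orbits are differences of antiderivatives of a continuous function, hence continuously
differentiable with explicit derivative. Using them in place of general elements of the domain
avoids the theory of generators.\<close>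

definition orbit_integral :: "(real \<Rightarrow> 'h::complex_hilbert \<Rightarrow> 'h) \<Rightarrow> 'h \<Rightarrow> real \<Rightarrow> 'h"
  where "orbit_integral S x t = integral {0..t} (\<lambda>s. S s x)"

lemma orbit_integral_derivative:
  assumes "C0_semigroup S" "t \<in> {0..L}"
  shows "(orbit_integral S x has_vector_derivative S t x) (at t within {0..L})"
  unfolding orbit_integral_def
  by (rule integral_has_vector_derivative[OF _ assms(2)])
     (rule continuous_on_subset[OF C0_semigroupD(4)[OF assms(1)]], auto)

text \<open>Differentiability relative to the whole half-line, so that one fact serves the interval \<open>[0, T]\<close> and the right derivative in the definition of the generator.\<close>

lemma orbit_integral_shift_derivative:
  assumes S: "C0_semigroup S" and "c \<ge> 0" "t \<ge> 0"
  shows "((\<lambda>s. orbit_integral S x (c + s)) has_vector_derivative S (c + t) x) (at t within {0..})"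
proof -
  have "((orbit_integral S x \<circ> (\<lambda>s. c + s)) has_vector_derivative 1 *\<^sub>R S (c + t) x) (at t within {0..t+1})"
  proof (rule vector_diff_chain_within)
    show "((\<lambda>s. c + s) has_vector_derivative 1) (at t within {0..t+1})"
      by (auto intro!: derivative_eq_intros)
    show "(orbit_integral S x has_vector_derivative S (c + t) x) (at (c + t) within (\<lambda>s. c + s) ` {0..t+1})"
      by (rule has_vector_derivative_within_subset[OF orbit_integral_derivative[OF S, of _ "c + t + 1"]])
         (use assms in auto)
  qed
  moreover have "at t within {0..t+1} = at t within {0..}"
    using assms by (intro at_within_nhd[of _ "{..<t+1}"]) auto
  ultimately show ?thesis by (simp add: o_def)
qed

text \<open>Move \<open>S t\<close> under the integral and use \<open>S t (S s x) = S (t + s) x\<close>.\<close>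

lemma semigroup_orbit_integral:
  assumes S: "C0_semigroup S" and t: "t \<ge> 0" and k: "k \<ge> 0"
  shows "S t (orbit_integral S x k) = orbit_integral S x (t + k) - orbit_integral S x t"
proof -
  have "((\<lambda>s. S (t + s) x) has_integral orbit_integral S x (t + k) - orbit_integral S x (t + 0)) {0..k}"
    by (rule fundamental_theorem_of_calculus[OF k])
       (auto intro!: has_vector_derivative_within_subset[OF orbit_integral_shift_derivative[OF S t]])
  moreover have "((\<lambda>s. S t (S s x)) has_integral S t (orbit_integral S x k)) {0..k}"
  proof -
    have "((\<lambda>s. S s x) has_integral orbit_integral S x k) {0..k}"
      unfolding orbit_integral_def
      by (intro integrable_integral integrable_continuous_real continuous_on_subset[OF C0_semigroupD(4)[OF S]]) auto
    from has_integral_linear[OF this C0_semigroupD(1)[OF S t]] show ?thesis by (simp add: o_def)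
  qed
  then have "((\<lambda>s. S (t + s) x) has_integral S t (orbit_integral S x k)) {0..k}"
    by (rule has_integral_eq[rotated]) (use t C0_semigroupD(2)[OF S] in auto)
  ultimately show ?thesis by (metis add.right_neutral has_integral_unique)
qed

lemma orbit_of_orbit_integral_derivative:
  assumes S: "C0_semigroup S" and t: "t \<ge> 0" and k: "k \<ge> 0"
  shows "((\<lambda>s. S s (orbit_integral S x k)) has_vector_derivative S (t + k) x - S t x) (at t within {0..})"
proof -
  have "((\<lambda>s. orbit_integral S x (k + s) - orbit_integral S x (0 + s)) has_vector_derivative
      S (k + t) x - S (0 + t) x) (at t within {0..})"
    by (intro has_vector_derivative_diff orbit_integral_shift_derivative S t k order_refl)
  from has_vector_derivative_transform[OF _ _ this, of "\<lambda>s. S s (orbit_integral S x k)"] show ?thesis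
    using t k by (simp add: semigroup_orbit_integral[OF S] add.commute)
qed

lemma generator_orbit_integral:
  assumes S: "C0_semigroup S" and A: "is_generator S D A" and t: "t \<ge> 0" and k: "k \<ge> 0"
  shows "S t (orbit_integral S x k) \<in> D"
    and "A (S t (orbit_integral S x k)) = S (t + k) x - S t x"
proof -
  let ?y = "orbit_integral S x k"
  have "((\<lambda>s. S s ?y) has_vector_derivative S (t + k) x - S t x) (at_right t)"
    by (rule has_vector_derivative_within_subset[OF orbit_of_orbit_integral_derivative[OF S t k]]) (use t in auto)
  then have "((\<lambda>s. (1 / (s - t)) *\<^sub>R (S s ?y - S t ?y)) \<longlongrightarrow> S (t + k) x - S t x) (at_right t)"
    by (simp add: has_vector_derivative_iff_quotient)
  then have "((\<lambda>h. (1 / h) *\<^sub>R (S (h + t) ?y - S t ?y)) \<longlongrightarrow> S (t + k) x - S t x) (at_right 0)"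
    by (subst (asm) filterlim_at_right_to_0) simp
  then have lim: "((\<lambda>h. (1 / h) *\<^sub>R (S h (S t ?y) - S t ?y)) \<longlongrightarrow> S (t + k) x - S t x) (at_right 0)"
  proof (rule Lim_transform_eventually)
    show "\<forall>\<^sub>F h in at_right 0. (1 / h) *\<^sub>R (S (h + t) ?y - S t ?y) = (1 / h) *\<^sub>R (S h (S t ?y) - S t ?y)"
      by (rule eventually_mono[OF eventually_at_right_less]) (use t C0_semigroupD(2)[OF S] in auto)
  qed
  then show D: "S t ?y \<in> D" using A by (auto simp: is_generator_def)
  then have "((\<lambda>h. (1 / h) *\<^sub>R (S h (S t ?y) - S t ?y)) \<longlongrightarrow> A (S t ?y)) (at_right 0)"
    using A by (auto simp: is_generator_def)
  with lim show "A (S t ?y) = S (t + k) x - S t x"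
    by (intro tendsto_unique[OF trivial_limit_at_right_real])
qed

text \<open>The supremum that defines \<open>r\<close> runs over the open half-plane, while the energy inequality uses its
boundary. For \<open>q = resolvent D A z y\<close> the identity \<open>(z + \<epsilon> - A) q = y + \<epsilon> q\<close> gives
\<open>\<bar>q\<bar> \<le> (\<bar>y\<bar> + \<epsilon> \<bar>q\<bar>) / r\<close> for every \<open>\<epsilon> > 0\<close>; let \<open>\<epsilon>\<close> tend to 0.\<close>

lemma resolvent_bound_half_plane:
  assumes res: "{z. Re z \<ge> \<omega>} \<subseteq> resolvent_set D A"
    and bdd: "bdd_above ((\<lambda>z. onorm (resolvent D A z)) ` {z. Re z \<ge> \<omega>})"
    and r: "r > 0" "1 / r = (SUP z\<in>{z. Re z > \<omega>}. onorm (resolvent D A z))"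
    and z: "Re z \<ge> \<omega>"
  shows "norm (resolvent D A z y) \<le> norm y / r"
proof -
  have inside: "norm (resolvent D A z y) \<le> norm y / r" if z: "Re z > \<omega>" for z y
  proof -
    have "bounded_linear (resolvent D A z)"
      using subsetD[OF res, of z] z by (simp add: resolvent_set_def bounded_clinear_def)
    then have "norm (resolvent D A z y) \<le> onorm (resolvent D A z) * norm y"
      by (rule onorm)
    also have "onorm (resolvent D A z) \<le> 1 / r"
      unfolding r(2) using z by (intro cSUP_upper bdd_above_mono[OF bdd]) auto
    finally show ?thesis by (simp add: mult_right_mono divide_inverse mult.commute)
  qed
  define q where "q = resolvent D A z y"
  have bij: "bij_betw (\<lambda>x. w *\<^sub>C x - A x) D UNIV" if "Re w \<ge> \<omega>" for w
    using subsetD[OF res, of w] that by (simp add: resolvent_set_def)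
  have q: "q \<in> D" "z *\<^sub>C q - A q = y"
    using bij[OF z] inv_into_into[of y "\<lambda>x. z *\<^sub>C x - A x" D] f_inv_into_f[of y "\<lambda>x. z *\<^sub>C x - A x" D]
    by (auto simp: q_def resolvent_def bij_betw_def)
  have "norm q \<le> (norm y + \<epsilon> * norm q) / r" if "\<epsilon> > 0" for \<epsilon>
  proof -
    have "(z + of_real \<epsilon>) *\<^sub>C q - A q = y + \<epsilon> *\<^sub>R q"
      using q by (simp add: scaleC_add_left scaleR_scaleC algebra_simps)
    moreover have "inj_on (\<lambda>x. (z + of_real \<epsilon>) *\<^sub>C x - A x) D"
      using bij[of "z + of_real \<epsilon>"] z that by (simp add: bij_betw_def)
    ultimately have "resolvent D A (z + of_real \<epsilon>) (y + \<epsilon> *\<^sub>R q) = q"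
      unfolding resolvent_def using q(1) by (metis (no_types, lifting) inv_into_f_f)
    then have "norm q \<le> norm (y + \<epsilon> *\<^sub>R q) / r"
      using inside[of "z + of_real \<epsilon>" "y + \<epsilon> *\<^sub>R q"] z that by simp
    also have "\<dots> \<le> (norm y + \<epsilon> * norm q) / r"
      using norm_triangle_ineq[of y "\<epsilon> *\<^sub>R q"] that r by (intro divide_right_mono) auto
    finally show ?thesis .
  qed
  then have "\<forall>\<^sub>F \<epsilon> in at_right 0. norm q \<le> (norm y + \<epsilon> * norm q) / r"
    by (intro eventually_mono[OF eventually_at_right_less]) auto
  moreover have "((\<lambda>\<epsilon>. (norm y + \<epsilon> * norm q) / r) \<longlongrightarrow> (norm y + 0 * norm q) / r) (at_right 0)"
    by (intro tendsto_intros) (use r in auto)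
  ultimately have "norm q \<le> (norm y + 0 * norm q) / r"
    by (intro tendsto_lowerbound) auto
  then show ?thesis by (simp add: q_def)
qed

lemma orbit_integral_average_tendsto:
  assumes S: "C0_semigroup S"
  shows "((\<lambda>k. (1 / k) *\<^sub>R orbit_integral S x k) \<longlongrightarrow> x) (at_right 0)"
proof -
  have "(orbit_integral S x has_vector_derivative S 0 x) (at_right 0)"
    using has_vector_derivative_within_subset[OF orbit_integral_shift_derivative[OF S, of 0 0 x], of "{0<..}"]
    by force
  then show ?thesis
    by (simp add: has_vector_derivative_iff_quotient orbit_integral_def C0_semigroupD(3)[OF S])
qed

lemma orbit_energy_inequality:
  fixes S :: "real \<Rightarrow> 'h::complex_hilbert \<Rightarrow> 'h"
  assumes S: "C0_semigroup S" and A: "is_generator S D A" and k: "k \<ge> 0"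
    and res: "\<And>z. Re z = \<omega> \<Longrightarrow> z \<in> resolvent_set D A"
    and R: "\<And>z y. Re z = \<omega> \<Longrightarrow> norm (resolvent D A z y) \<le> norm y / r" and r: "r > 0"
    and T: "T > 0" and F: "finite F" and \<Phi>: "continuous_on {0..T} \<Phi>"
    and \<phi>: "\<And>s. s \<in> {0<..<T} - F \<Longrightarrow> (\<Phi> has_vector_derivative \<phi> s) (at s)"
    and ends: "\<Phi> 0 = 0" "\<Phi> T = 0"
    and J: "((\<lambda>s. ((\<phi> s)\<^sup>2 - r\<^sup>2 * (\<Phi> s)\<^sup>2) *
      (exp (- \<omega> * s) * norm (S s (orbit_integral S x k)))\<^sup>2) has_integral J) {0..T}"
  shows "0 \<le> J"
proof -
  define y where "y = orbit_integral S x k"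
  define p where "p s = exp (- \<omega> * s) *\<^sub>R S s y" for s
  define p' where "p' s = exp (- \<omega> * s) *\<^sub>R (S (s + k) x - S s x) - \<omega> *\<^sub>R p s" for s
  define R' where "R' \<xi> = resolvent D A (of_real \<omega> + \<i> * of_real \<xi>)" for \<xi>
  have cS: "continuous_on {0..T} (\<lambda>s. S s v)" for v
    by (rule continuous_on_subset[OF C0_semigroupD(4)[OF S]]) auto
  show ?thesis
  proof (rule energy_inequality[OF T r _ _ _ _ _ F \<Phi> \<phi> ends])
    show "(p has_vector_derivative p' s) (at s within {0..T})" if s: "s \<in> {0..T}" for s
    proof -
      have "((\<lambda>s. exp (- \<omega> * s)) has_real_derivative - \<omega> * exp (- \<omega> * s)) (at s within {0..T})"
        by (auto intro!: derivative_eq_intros)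
      moreover have "((\<lambda>s. S s y) has_vector_derivative S (s + k) x - S s x) (at s within {0..T})"
        unfolding y_def
        by (rule has_vector_derivative_within_subset[OF orbit_of_orbit_integral_derivative[OF S _ k]])
           (use s in auto)
      ultimately show ?thesis
        unfolding p_def[abs_def] p'_def using has_vector_derivative_scaleR[of "\<lambda>s. exp (- \<omega> * s)"]
        by fastforce
    qed
    show "continuous_on {0..T} p'"
    proof -
      have "continuous_on {0..T} (\<lambda>s. S (s + k) x)"
        by (rule continuous_on_compose2[OF C0_semigroupD(4)[OF S]]) (use k in \<open>auto intro!: continuous_intros\<close>)
      then show ?thesis unfolding p'_def p_def by (intro continuous_intros cS)
    qed
    show "bounded_clinear (R' \<xi>)" for \<xi>
      using res[of "of_real \<omega> + \<i> * of_real \<xi>"] by (simp add: R'_def resolvent_set_def)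
    show "norm (R' \<xi> v) \<le> norm v / r" for \<xi> v
      unfolding R'_def by (rule R) simp
    show "p s = R' \<xi> ((\<i> * of_real \<xi>) *\<^sub>C p s - p' s)" if "s \<in> {0..T}" for \<xi> s
    proof -
      define z where "z = of_real \<omega> + \<i> * of_real \<xi>"
      have s: "s \<ge> 0" using that by simp
      have z: "z \<in> resolvent_set D A" by (rule res) (simp add: z_def)
      have "R' \<xi> (z *\<^sub>C S s y - A (S s y)) = S s y"
        using z generator_orbit_integral(1)[OF S A s k, of x]
        by (auto simp: R'_def z_def[symmetric] resolvent_def y_def resolvent_set_def bij_betw_def
            intro: inv_into_f_f)
      moreover have "(\<i> * of_real \<xi>) *\<^sub>C p s - p' s = exp (- \<omega> * s) *\<^sub>R (z *\<^sub>C S s y - A (S s y))"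
        unfolding y_def generator_orbit_integral(2)[OF S A s k, of x]
        unfolding y_def[symmetric] p'_def z_def scaleC_add_left p_def
        by (simp add: scaleR_scaleC[symmetric] scaleC_scaleR algebra_simps)
      moreover have "bounded_linear (R' \<xi>)"
        using z by (simp add: R'_def z_def[symmetric] resolvent_set_def bounded_clinear_def)
      ultimately show ?thesis by (simp add: p_def linear_cmul bounded_linear.linear)
    qed
    show "((\<lambda>s. ((\<phi> s)\<^sup>2 - r\<^sup>2 * (\<Phi> s)\<^sup>2) * (norm (p s))\<^sup>2) has_integral J) {0..T}"
      using J by (simp add: p_def y_def)
  qed
qed

section \<open>Growth and decay of the semigroup\<close>

definition exponentially_bounded :: "(real \<Rightarrow> 'h::complex_hilbert \<Rightarrow> 'h) \<Rightarrow> real \<Rightarrow> bool"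
  where "exponentially_bounded S \<sigma> \<longleftrightarrow> (\<exists>C. \<forall>t\<ge>0. \<forall>x. norm (S t x) \<le> C * exp (\<sigma> * t) * norm x)"

lemma exponentially_bounded_mono:
  assumes "exponentially_bounded S \<sigma>" "\<sigma> \<le> \<tau>"
  shows "exponentially_bounded S \<tau>"
proof -
  obtain C where C: "\<And>t x. t \<ge> 0 \<Longrightarrow> norm (S t x) \<le> C * exp (\<sigma> * t) * norm x"
    using assms by (auto simp: exponentially_bounded_def)
  have "norm (S t x) \<le> \<bar>C\<bar> * exp (\<tau> * t) * norm x" if "t \<ge> 0" for t x
  proof -
    have "C * exp (\<sigma> * t) * norm x \<le> \<bar>C\<bar> * exp (\<tau> * t) * norm x"
      using assms that by (intro mult_right_mono mult_mono) (auto simp: mult_right_mono)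
    then show ?thesis using C[OF that, of x] by linarith
  qed
  then show ?thesis by (auto simp: exponentially_bounded_def)
qed

lemma locally_bounded_semigroup:
  fixes S :: "real \<Rightarrow> 'h::complex_hilbert \<Rightarrow> 'h"
  assumes m: "continuous_on {0..} m" and Sm: "\<And>t x. t \<ge> 0 \<Longrightarrow> norm (S t x) \<le> m t * norm x"
  obtains M where "M \<ge> 1" "\<And>t x. t \<in> {0..L} \<Longrightarrow> norm (S t x) \<le> M * norm x"
proof -
  have "compact (m ` {0..L})"
    by (intro compact_continuous_image continuous_on_subset[OF m]) auto
  then obtain B where "\<forall>y\<in>m ` {0..L}. norm y \<le> B"
    using compact_imp_bounded bounded_iff by blast
  then have B: "norm (m t) \<le> B" if "t \<in> {0..L}" for t using that by blast
  have "norm (S t x) \<le> max 1 B * norm x" if "t \<in> {0..L}" for t x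
  proof -
    have "m t * norm x \<le> max 1 B * norm x"
      using B[OF that] by (intro mult_right_mono) auto
    then show ?thesis using Sm[of t x] that by simp
  qed
  then show ?thesis using that[of "max 1 B"] by auto
qed

text \<open>The usual argument: \<open>S t\<close> is a product of about \<open>t\<close> operators of norm at most \<open>M\<close>, the bound on \<open>[0, 1]\<close>; the type is \<open>ln M\<close>.\<close>

lemma exponentially_bounded_semigroup:
  fixes S :: "real \<Rightarrow> 'h::complex_hilbert \<Rightarrow> 'h"
  assumes S: "C0_semigroup S" and m: "continuous_on {0..} m"
    and Sm: "\<And>t x. t \<ge> 0 \<Longrightarrow> norm (S t x) \<le> m t * norm x"
  shows "\<exists>\<sigma>. exponentially_bounded S \<sigma>"
proof -
  obtain M where M: "M \<ge> 1" "\<And>t x. t \<in> {0..1} \<Longrightarrow> norm (S t x) \<le> M * norm x"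
    using locally_bounded_semigroup[of m S 1] m Sm by blast
  have "norm (S t x) \<le> M * exp (ln M * t) * norm x" if "0 \<le> t" "t \<le> real n + 1" for t x n
    using that
  proof (induction n arbitrary: t)
    case 0
    have "M * 1 \<le> M * exp (ln M * t)" using M 0 by (intro mult_left_mono) auto
    then have "M * norm x \<le> M * exp (ln M * t) * norm x" by (intro mult_right_mono) auto
    then show ?case using M(2)[of t x] 0 by simp
  next
    case (Suc n)
    show ?case
    proof (cases "t \<le> real n + 1")
      case True then show ?thesis using Suc by blast
    next
      case False
      have "norm (S t x) = norm (S 1 (S (t - 1) x))"
        using C0_semigroupD(2)[OF S, of 1 "t - 1" x] False by simp
      also have "\<dots> \<le> M * norm (S (t - 1) x)" by (rule M(2)) simp
      also have "\<dots> \<le> M * (M * exp (ln M * (t - 1)) * norm x)"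
        using Suc False M by (intro mult_left_mono) auto
      also have "M * (M * exp (ln M * (t - 1)) * norm x) = M * exp (ln M * t) * norm x"
        using M(1) by (simp add: right_diff_distrib exp_diff)
      finally show ?thesis .
    qed
  qed
  then have "norm (S t x) \<le> M * exp (ln M * t) * norm x" if "t \<ge> 0" for t x
    using that real_nat_ceiling_ge[of t] by (meson add_increasing2 zero_le_one)
  then show ?thesis by (auto simp: exponentially_bounded_def)
qed

lemma weighted_L2_norm_inverse:
  fixes m :: "real \<Rightarrow> real"
  assumes m: "continuous_on {0..} m" and pos: "\<And>t. t \<ge> 0 \<Longrightarrow> m t > 0"
  shows "weighted_L2_norm \<omega> a (\<lambda>s. 1 / m s) = sqrt (integral {0..a} (\<lambda>s. (exp (\<omega> * s) / m s)\<^sup>2))"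
proof -
  define f where "f s = (exp (\<omega> * s) / m s)\<^sup>2" for s
  have f: "exp (2 * \<omega> * s) * \<bar>1 / m s\<bar>\<^sup>2 = f s" for s
    by (simp add: f_def power_divide exp_double[symmetric] mult.assoc)
  have cf: "continuous_on {0..a} f"
    unfolding f_def using pos
    by (intro continuous_intros continuous_on_subset[OF m]) (auto simp: less_imp_neq[symmetric])
  have "set_integrable lborel {0..a} f"
    by (rule borel_integrable_atLeastAtMost'[OF cf])
  then have "set_integrable lborel {0<..<a} f"
    by (rule set_integrable_subset) auto
  then have "(LINT s:{0<..<a}|lborel. f s) = integral {0<..<a} f"
    by (rule set_borel_integral_eq_integral)
  also have "\<dots> = integral {0..a} f" by (simp add: integral_open_interval_real)
  finally have "(LINT s:{0<..<a}|lborel. f s) = integral {0..a} f" .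
  then show ?thesis unfolding weighted_L2_norm_def f by (simp only: f_def[abs_def])
qed

lemma weighted_L2_norm_inverse_pos:
  fixes m :: "real \<Rightarrow> real"
  assumes m: "continuous_on {0..} m" and pos: "\<And>t. t \<ge> 0 \<Longrightarrow> m t > 0" and a: "a > 0"
  shows "weighted_L2_norm \<omega> a (\<lambda>s. 1 / m s) > 0"
proof -
  let ?f = "\<lambda>s. (exp (\<omega> * s) / m s)\<^sup>2"
  have cf: "continuous_on {0..a} ?f"
    using pos by (intro continuous_intros continuous_on_subset[OF m]) (auto simp: less_imp_neq[symmetric])
  have "integral {0..a} ?f \<noteq> 0"
    using integral_eq_0_iff[OF cf a] pos[of a] a by force
  moreover have "integral {0..a} ?f \<ge> 0" by (intro integral_nonneg integrable_continuous_real cf) auto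
  ultimately show ?thesis by (simp add: weighted_L2_norm_inverse[OF m pos])
qed

text \<open>The claimed estimate under the additional assumption of a moderate growth rate. It is proved for
the vectors \<open>orbit_integral S x k\<close>, whose orbits satisfy the energy inequality, and extends to all
vectors by density.\<close>

lemma semigroup_decay_of_growth:
  fixes S :: "real \<Rightarrow> 'h::complex_hilbert \<Rightarrow> 'h"
  assumes S: "C0_semigroup S" and A: "is_generator S D A"
    and res: "\<And>z. Re z = \<omega> \<Longrightarrow> z \<in> resolvent_set D A"
    and R: "\<And>z y. Re z = \<omega> \<Longrightarrow> norm (resolvent D A z y) \<le> norm y / r" and r: "r > 0"
    and m: "continuous_on {0..} m" and pos: "\<And>t. t \<ge> 0 \<Longrightarrow> m t > 0"
    and Sm: "\<And>t x. t \<ge> 0 \<Longrightarrow> norm (S t x) \<le> m t * norm x"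
    and growth: "exponentially_bounded S (\<omega> + r / 2)"
    and a: "a > 0" and b: "b > 0" and t: "t > a + b"
  shows "norm (S t x) \<le> exp (\<omega> * t - r * (t - a - b)) / r *
      (1 / (weighted_L2_norm \<omega> a (\<lambda>s. 1 / m s) * weighted_L2_norm \<omega> b (\<lambda>s. 1 / m s))) * norm x"
proof -
  let ?W = "\<lambda>a. weighted_L2_norm \<omega> a (\<lambda>s. 1 / m s)"
  define c where "c = r * exp (r * (t - a - b)) * ?W a * ?W b * exp (- \<omega> * t)"
  have t0: "t \<ge> 0" using a b t by simp
  obtain C where C: "\<And>t x. t \<ge> 0 \<Longrightarrow> norm (S t x) \<le> C * exp ((\<omega> + r / 2) * t) * norm x"
    using growth by (auto simp: exponentially_bounded_def)
  have smooth: "c * norm (S t y) \<le> norm y" if y: "y = orbit_integral S x k" and k: "k \<ge> 0" for k y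
  proof -
    define u where "u s = exp (- \<omega> * s) * norm (S s y)" for s
    define g where "g s = exp (\<omega> * s) / m s" for s
    have "r * exp (r * (t - a - b)) * sqrt (integral {0..a} (\<lambda>s. (g s)\<^sup>2)) *
        sqrt (integral {0..b} (\<lambda>s. (g s)\<^sup>2)) * u t \<le> norm y"
    proof (rule weighted_decay_from_energy[OF r a b t])
      show "continuous_on {0..} u"
        unfolding u_def by (intro continuous_intros C0_semigroupD(4)[OF S])
      show "continuous_on {0..} g"
        unfolding g_def using pos by (intro continuous_intros m) (auto simp: less_imp_neq[symmetric])
      show "u s \<ge> 0" for s by (simp add: u_def)
      show "g s > 0" if "s \<ge> 0" for s using pos[OF that] by (simp add: g_def)
      show "0 \<le> J" if "T > 0" "finite F" "continuous_on {0..T} \<Phi>"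
        "\<And>s. s \<in> {0<..<T} - F \<Longrightarrow> (\<Phi> has_vector_derivative \<phi> s) (at s)" "\<Phi> 0 = 0" "\<Phi> T = 0"
        "((\<lambda>s. ((\<phi> s)\<^sup>2 - r\<^sup>2 * (\<Phi> s)\<^sup>2) * (u s)\<^sup>2) has_integral J) {0..T}" for T \<Phi> \<phi> F J
        using orbit_energy_inequality[OF S A k res R r that(1-6)] that(7) by (simp add: u_def y)
      show "u s * g s \<le> norm y" if "s \<in> {0..a}" for s
        using Sm[of s y] pos[of s] that by (simp add: u_def g_def exp_minus field_simps)
      show "u t * g (t - s) \<le> u s" if s: "s \<in> {t - b..t}" for s
      proof -
        have s0: "s \<ge> 0" using s a t by simp
        have "norm (S t y) \<le> m (t - s) * norm (S s y)"
          using Sm[of "t - s" "S s y"] C0_semigroupD(2)[OF S, of "t - s" s y] s s0 by simp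
        then have "norm (S t y) / m (t - s) \<le> norm (S s y)"
          using pos[of "t - s"] s by (simp add: field_simps)
        then have "exp (- \<omega> * s) * (norm (S t y) / m (t - s)) \<le> u s"
          unfolding u_def by (rule mult_left_mono) simp
        moreover have "exp (- \<omega> * t) * exp (\<omega> * (t - s)) = exp (- \<omega> * s)"
          by (simp add: exp_add[symmetric] algebra_simps)
        then have "u t * g (t - s) = exp (- \<omega> * s) * (norm (S t y) / m (t - s))"
          unfolding u_def g_def by (metis mult.assoc mult.commute times_divide_eq_right)
        ultimately show ?thesis by simp
      qed
      show "u s \<le> (C * norm y) * exp (r / 2 * s)" if "s \<ge> 0" for s
      proof -
        have "u s \<le> exp (- \<omega> * s) * (C * exp ((\<omega> + r / 2) * s) * norm y)"
          unfolding u_def by (intro mult_left_mono C that) simp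
        also have "\<dots> = (C * norm y) * (exp (- \<omega> * s) * exp ((\<omega> + r / 2) * s))" by simp
        also have "exp (- \<omega> * s) * exp ((\<omega> + r / 2) * s) = exp (r / 2 * s)"
          by (simp add: exp_add[symmetric] algebra_simps)
        finally show ?thesis .
      qed
    qed
    then show ?thesis
      by (simp add: c_def weighted_L2_norm_inverse[OF m pos] u_def g_def mult_ac)
  qed
  have "c * norm (S t x) \<le> norm x"
  proof (rule tendsto_le)
    let ?y = "\<lambda>k. (1 / k) *\<^sub>R orbit_integral S x k"
    show "((\<lambda>k. norm (?y k)) \<longlongrightarrow> norm x) (at_right 0)"
      by (rule tendsto_norm[OF orbit_integral_average_tendsto[OF S]])
    show "((\<lambda>k. c * norm (S t (?y k))) \<longlongrightarrow> c * norm (S t x)) (at_right 0)"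
      by (rule tendsto_mult_left[OF tendsto_norm[OF bounded_linear.tendsto[OF C0_semigroupD(1)[OF S t0]
          orbit_integral_average_tendsto[OF S]]]])
    show "\<forall>\<^sub>F k in at_right 0. c * norm (S t (?y k)) \<le> norm (?y k)"
    proof (rule eventually_mono[OF eventually_at_right_less])
      fix k :: real assume k: "0 < k"
      have "S t (?y k) = (1 / k) *\<^sub>R S t (orbit_integral S x k)"
        by (intro linear_cmul bounded_linear.linear C0_semigroupD(1)[OF S t0])
      then show "c * norm (S t (?y k)) \<le> norm (?y k)"
        using smooth[OF refl, of k] k by (simp add: divide_simps)
    qed
  qed simp
  moreover have "c > 0"
    using r weighted_L2_norm_inverse_pos[OF m pos a, of \<omega>] weighted_L2_norm_inverse_pos[OF m pos b, of \<omega>]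
    by (simp add: c_def)
  ultimately have "norm (S t x) \<le> norm x / c"
    by (simp add: field_simps)
  also have "norm x / c = exp (\<omega> * t - r * (t - a - b)) / r * (1 / (?W a * ?W b)) * norm x"
  proof -
    have "exp (\<omega> * t - r * (t - a - b)) = 1 / (exp (r * (t - a - b)) * exp (- \<omega> * t))"
      by (simp add: exp_minus exp_diff inverse_eq_divide)
    then show ?thesis by (simp add: c_def mult_ac)
  qed
  finally show ?thesis .
qed

text \<open>By the decay estimate with \<open>a = b = 1\<close>, exponential type \<open>\<mu> + r / 2\<close> improves to \<open>\<mu>\<close> for every
\<open>\<mu> \<ge> \<omega>\<close>, the times up to 2 being covered by local boundedness. Descending from \<open>\<omega> + n * r / 2\<close> in
\<open>n\<close> steps reaches \<open>\<omega>\<close>. This is where the resolvent bound on the whole half-plane enters.\<close>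

lemma exponentially_bounded_bootstrap:
  fixes S :: "real \<Rightarrow> 'h::complex_hilbert \<Rightarrow> 'h"
  assumes S: "C0_semigroup S" and A: "is_generator S D A"
    and res: "\<And>z. Re z \<ge> \<omega> \<Longrightarrow> z \<in> resolvent_set D A"
    and R: "\<And>z y. Re z \<ge> \<omega> \<Longrightarrow> norm (resolvent D A z y) \<le> norm y / r" and r: "r > 0"
    and m: "continuous_on {0..} m" and pos: "\<And>t. t \<ge> 0 \<Longrightarrow> m t > 0"
    and Sm: "\<And>t x. t \<ge> 0 \<Longrightarrow> norm (S t x) \<le> m t * norm x"
  shows "exponentially_bounded S \<omega>"
proof -
  have step: "exponentially_bounded S \<mu>" if \<mu>: "\<mu> \<ge> \<omega>" and gr: "exponentially_bounded S (\<mu> + r / 2)" for \<mu>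
  proof -
    obtain M where M: "M \<ge> 1" "\<And>t x. t \<in> {0..2} \<Longrightarrow> norm (S t x) \<le> M * norm x"
      using locally_bounded_semigroup[of m S 2] m Sm by blast
    define W where "W = weighted_L2_norm \<mu> 1 (\<lambda>s. 1 / m s)"
    have W: "W > 0" unfolding W_def by (rule weighted_L2_norm_inverse_pos[OF m pos]) auto
    define C where "C = max (M * exp (2 * \<bar>\<mu>\<bar>)) (1 / r * (1 / (W * W)))"
    have "norm (S t x) \<le> C * exp (\<mu> * t) * norm x" if t: "t \<ge> 0" for t x
    proof (cases "t \<le> 2")
      case True
      have "- \<mu> * t \<le> \<bar>\<mu>\<bar> * t" using t by (intro mult_right_mono) auto
      also have "\<dots> \<le> \<bar>\<mu>\<bar> * 2" using True by (intro mult_left_mono) auto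
      finally have "0 \<le> 2 * \<bar>\<mu>\<bar> + \<mu> * t" by simp
      then have "M * 1 \<le> M * (exp (2 * \<bar>\<mu>\<bar>) * exp (\<mu> * t))"
        using M(1) by (intro mult_left_mono) (auto simp: exp_add[symmetric])
      also have "\<dots> \<le> C * exp (\<mu> * t)"
        by (simp add: C_def mult.assoc[symmetric])
      finally have "M * norm x \<le> C * exp (\<mu> * t) * norm x"
        by (intro mult_right_mono) auto
      then show ?thesis using M(2)[of t x] True t by simp
    next
      case False
      have "norm (S t x) \<le> exp (\<mu> * t - r * (t - 1 - 1)) / r * (1 / (W * W)) * norm x"
        unfolding W_def
        by (rule semigroup_decay_of_growth[OF S A _ _ r m pos Sm gr])
           (use \<mu> res R False in auto)
      also have "\<dots> \<le> exp (\<mu> * t) / r * (1 / (W * W)) * norm x"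
        using r W False by (intro mult_right_mono divide_right_mono) auto
      also have "\<dots> = (1 / r * (1 / (W * W))) * exp (\<mu> * t) * norm x" by simp
      also have "\<dots> \<le> C * exp (\<mu> * t) * norm x"
        by (intro mult_right_mono) (auto simp: C_def)
      finally show ?thesis .
    qed
    then show ?thesis by (auto simp: exponentially_bounded_def)
  qed
  have descend: "exponentially_bounded S \<omega>" if "exponentially_bounded S (\<omega> + real n * (r / 2))" for n
    using that
  proof (induction n)
    case (Suc n)
    have eq: "\<omega> + real (Suc n) * (r / 2) = (\<omega> + real n * (r / 2)) + r / 2"
      by (simp add: algebra_simps)
    have "exponentially_bounded S (\<omega> + real n * (r / 2))"
      by (rule step) (use Suc.prems r in \<open>simp_all only: eq\<close>, simp)
    then show ?case by (rule Suc.IH)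
  qed simp
  obtain \<sigma> where \<sigma>: "exponentially_bounded S \<sigma>"
    using exponentially_bounded_semigroup[OF S m Sm] by blast
  obtain n :: nat where "\<sigma> - \<omega> < real n * (r / 2)"
    using reals_Archimedean3[of "r / 2"] r by (metis half_gt_zero)
  then show ?thesis
    by (intro descend[of n] exponentially_bounded_mono[OF \<sigma>]) simp
qed

theorem theorem1p7:
  fixes S :: "real \<Rightarrow> 'h::complex_hilbert \<Rightarrow> 'h"
    and D :: "'h set"
    and A :: "'h \<Rightarrow> 'h"
    and \<omega> r :: real
    and m :: "real \<Rightarrow> real"
  assumes "C0_semigroup S"
    and "is_generator S D A"
    and "{z. Re z \<ge> \<omega>} \<subseteq> resolvent_set D A"
    and "bdd_above ((\<lambda>z. onorm (resolvent D A z)) ` {z. Re z \<ge> \<omega>})"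
    and "r > 0"
    and "1 / r = (SUP z\<in>{z. Re z > \<omega>}. onorm (resolvent D A z))"
    and "continuous_on {0..} m"
    and "\<forall>t\<ge>0. m t > 0"
    and "\<forall>t\<ge>0. onorm (S t) \<le> m t"
  shows "\<forall>a>0. \<forall>b>0. \<forall>t>a + b.
    onorm (S t) \<le> exp (\<omega> * t - r * (t - a - b)) / r *
      (1 / (weighted_L2_norm \<omega> a (\<lambda>s. 1 / m s) * weighted_L2_norm \<omega> b (\<lambda>s. 1 / m s)))"
proof (intro allI impI)
  fix a b t :: real assume ab: "a > 0" "b > 0" "t > a + b"
  have res: "z \<in> resolvent_set D A" if "Re z \<ge> \<omega>" for z
    using assms(3) that by blast
  have R: "norm (resolvent D A z y) \<le> norm y / r" if "Re z \<ge> \<omega>" for z y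
    by (rule resolvent_bound_half_plane[OF assms(3,4,5,6) that])
  have pos: "m t > 0" if "t \<ge> 0" for t using assms(8) that by blast
  have Sm: "norm (S t x) \<le> m t * norm x" if "t \<ge> 0" for t x
  proof -
    have "norm (S t x) \<le> onorm (S t) * norm x"
      by (rule onorm[OF C0_semigroupD(1)[OF assms(1) that]])
    also have "\<dots> \<le> m t * norm x" using assms(9) that by (intro mult_right_mono) auto
    finally show ?thesis .
  qed
  have "exponentially_bounded S (\<omega> + r / 2)"
  proof (rule exponentially_bounded_mono)
    show "exponentially_bounded S \<omega>"
      by (rule exponentially_bounded_bootstrap[OF assms(1,2) _ _ assms(5,7)]) (use res R pos Sm in auto)
  qed (use assms(5) in simp)
  then have "norm (S t x) \<le> exp (\<omega> * t - r * (t - a - b)) / r *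
      (1 / (weighted_L2_norm \<omega> a (\<lambda>s. 1 / m s) * weighted_L2_norm \<omega> b (\<lambda>s. 1 / m s))) * norm x" for x
    by (intro semigroup_decay_of_growth[OF assms(1,2) _ _ assms(5,7) _ _ _ ab]) (use res R pos Sm in auto)
  then show "onorm (S t) \<le> exp (\<omega> * t - r * (t - a - b)) / r *
      (1 / (weighted_L2_norm \<omega> a (\<lambda>s. 1 / m s) * weighted_L2_norm \<omega> b (\<lambda>s. 1 / m s)))"
  proof (rule onorm_bound[rotated])
    have "weighted_L2_norm \<omega> c (\<lambda>s. 1 / m s) > 0" if "c > 0" for c
      by (rule weighted_L2_norm_inverse_pos[OF assms(7) pos that])
    from this[OF ab(1)] this[OF ab(2)]
    show "0 \<le> exp (\<omega> * t - r * (t - a - b)) / r *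
      (1 / (weighted_L2_norm \<omega> a (\<lambda>s. 1 / m s) * weighted_L2_norm \<omega> b (\<lambda>s. 1 / m s)))"
      using assms(5) by simp
  qed
qed

end
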